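(* Let $\omega\in\mathcal{W}_0$ be given with associated weight matrix $\mathcal{M}_\omega=\{\mathbb{W}^{(\ell)}:\ell>0\}$ and let $\alpha>1$. Suppose there exists $s>\alpha-1$ such that the function $\omega^s(t):=\omega(t^s)$ satisfies: (i) $\omega^s(t)=o(t)$ as $t\to\infty$; (ii) $\omega^s$ satisfies condition $(\alpha_0)$. Then the following are equivalent: (a) The matrix $\mathcal{M}_\omega$ satisfies $(\mathcal{M}_{\{\mathrm{rai}\}})$. (b) $\omega$ satisfies condition $(\alpha_0)$. (c) The class $\mathcal{A}_{\{\omega\}}(S_\alpha)$ is holomorphically closed. (d) The class $\mathcal{A}_{\{\omega\}}(S_\alpha)$ is inverse-closed. If in addition $\omega(t)=O(t)$ as $t\to+\infty$, then (a)–(d) are also equivalent to each of: (e) The class $\mathcal{A}_{\{\omega\}}(S_\alpha)$ is closed under composition. (f) The matrix $\mathcal{M}_\omega$ satisfies $(\mathcal{M}_{\{\mathrm{FdB}\}})$.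
   Context: $\mathbb{N}_0=\{0,1,2,\dots\}$, $\mathbb{N}=\{1,2,\dots\}$. $\mathcal{W}_0$ is the set of continuous nondecreasing $\omega:[0,\infty)\to[0,\infty)$ with $\omega(t)=0$ for $t\in[0,1]$, $\lim_{t\to\infty}\omega(t)=\infty$, $\ln t=o(\omega(t))$ as $t\to\infty$, and $\varphi_\omega:t\mapsto\omega(e^t)$ convex on $\mathbb{R}$. A function $\sigma$ satisfies $(\alpha_0)$ if $\exists C\ge1\ \exists t_0\ge0\ \forall\lambda\ge1\ \forall t\ge t_0$: $\sigma(\lambda t)\le C\lambda\sigma(t)$ (for such functions this amounts to being equivalent, in the sense of mutual $O$-bounds at infinity, to a concave weight function, i.e. a concave continuous nondecreasing function vanishing at $0$ and tending to $\infty$). For $\omega\in\mathcal{W}_0$, $\varphi^*_\omega(x):=\sup\{xy-\varphi_\omega(y):y\ge0\}$ for $x\ge0$, and the associated weight matrix is $\mathcal{M}_\omega=\{\mathbb{W}^{(\ell)}=(W^{(\ell)}_j)_{j\in\mathbb{N}_0}:\ell>0\}$ with $W^{(\ell)}_j:=\exp\left(\frac1\ell\varphi^*_\omega(\ell j)\right)$. Write $\check W^{(\ell)}_j:=W^{(\ell)}_j/j!$. - $(\mathcal{M}_{\{\mathrm{rai}\}})$ for $\mathcal{M}_\omega$: $\forall\ell>0\ \exists\ell'>0\ \exists H\ge1\ \forall1\le j\le k$: $(\check W^{(\ell)}_j)^{1/j}\le H(\check W^{(\ell')}_k)^{1/k}$. - $(\mathcal{M}_{\{\mathrm{FdB}\}})$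 for $\mathcal{M}_\omega$: $\forall\ell>0\ \exists\ell'>0\ \exists A,B>0\ \forall k\in\mathbb{N}_0$: $(\check W^{(\ell)})^\circ_k\le AB^k\check W^{(\ell')}_k$, where for a sequence $\check{\mathbb{M}}$ one sets $\check M^\circ_0:=1$ and $\check M^\circ_k:=\max\{\check M_n\check M_{j_1}\cdots\check M_{j_n}:n\in\mathbb{N},\ j_i\in\mathbb{N},\ \sum_{i=1}^nj_i=k\}$ for $k\ge1$. $\mathcal{R}$ is the Riemann surface of the logarithm and $S_\alpha:=\{z\in\mathcal{R}:|\arg z|<\alpha\pi/2\}$; derivatives are with respect to the coordinate $z$; $\mathcal{H}(\cdot)$ denotes holomorphic functions. $\mathcal{A}_{\{\omega\}}(S)$ is the set of $f\in\mathcal{H}(S)$ for which there is $\ell>0$ with $\sup_{z\in S,j\in\mathbb{N}_0}\frac{|f^{(j)}(z)|}{\exp(\frac1\ell\varphi^*_\omega(\ell j))}<\infty$. For $U\subseteq\mathbb{C}$ open, $\mathcal{H}_{\{\mathcal{M}_\omega\}}(U)$ is the set of $g\in\mathcal{H}(U)$ such that for each compact $K\subset U$ there are $\ell,h>0$ with $\sup_{z\in K,j\in\mathbb{N}_0}\frac{|g^{(j)}(z)|}{h^jW^{(\ell)}_j}<\infty$. The class $\mathcal{A}:=\mathcal{A}_{\{\omega\}}(S_\alpha)$ is: holomorphically closed if $g\circ f\in\mathcal{A}$ for all $f\in\mathcal{A}$ and all $g\in\mathcal{H}(U)$ with $U\subseteq\mathbb{C}$ open containing the closure of the range of $f$; inverse-closed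 if $1/f\in\mathcal{A}$ for all $f\in\mathcal{A}$ with $\inf_{z\in S_\alpha}|f(z)|>0$; closed under composition if $g\circ f\in\mathcal{A}$ for all $f\in\mathcal{A}$ and all $g\in\mathcal{H}_{\{\mathcal{M}_\omega\}}(U)$ with $U\subseteq\mathbb{C}$ open containing the closure of the range of $f$. *)

theory Defs
  imports "HOL-Complex_Analysis.Complex_Analysis" "HOL-Library.Landau_Symbols"
begin

section \<open>Weight functions and weight matrices\<close>

text \<open>
  Weight functions are total functions on the reals of which only the values on \<open>[0, \<infinity>)\<close> matter.
\<close>

definition weight_fun_W0 :: "(real \<Rightarrow> real) set" where
  "weight_fun_W0 = {\<omega>.
     continuous_on {0..} \<omega> \<and>
     mono_on {0..} \<omega> \<and>
     (\<forall>t\<ge>0. \<omega> t \<ge> 0) \<and>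
     (\<forall>t\<in>{0..1}. \<omega> t = 0) \<and>
     filterlim \<omega> at_top at_top \<and>
     (\<lambda>t. ln t) \<in> o[at_top](\<omega>) \<and>
     convex_on UNIV (\<lambda>y. \<omega> (exp y))}"

definition alpha0 :: "(real \<Rightarrow> real) \<Rightarrow> bool" where
  "alpha0 \<sigma> \<longleftrightarrow> (\<exists>C\<ge>1. \<exists>t0\<ge>0. \<forall>\<kappa>\<ge>1. \<forall>t\<ge>t0. \<sigma> (\<kappa> * t) \<le> C * \<kappa> * \<sigma> t)"

definition power_weight :: "(real \<Rightarrow> real) \<Rightarrow> real \<Rightarrow> real \<Rightarrow> real" where
  "power_weight \<omega> s = (\<lambda>t. \<omega> (t powr s))"

text \<open>
  For \<open>\<omega> \<in> weight_fun_W0\<close> and \<open>x \<ge> 0\<close> the supremum below is over a set that is bounded above,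
  because \<open>ln t = o(\<omega> t)\<close>; it is therefore the genuine supremum.
\<close>

definition young_conj :: "(real \<Rightarrow> real) \<Rightarrow> real \<Rightarrow> real" where
  "young_conj \<omega> x = (SUP y\<in>{0..}. x * y - \<omega> (exp y))"

definition weight_matrix :: "(real \<Rightarrow> real) \<Rightarrow> real \<Rightarrow> nat \<Rightarrow> real" where
  "weight_matrix \<omega> l j = exp (1 / l * young_conj \<omega> (l * real j))"

text \<open>A weight matrix is a function \<open>M\<close> of which only the rows \<open>M l\<close> with \<open>l > 0\<close> matter.\<close>

definition check_seq :: "(nat \<Rightarrow> real) \<Rightarrow> nat \<Rightarrow> real" where
  "check_seq M j = M j / fact j"

definition circ_seq :: "(nat \<Rightarrow> real) \<Rightarrow> nat \<Rightarrow> real" where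
  "circ_seq M k = (if k = 0 then 1 else
     Max {M n * (\<Prod>j\<leftarrow>js. M j) | n js.
            n \<ge> 1 \<and> length js = n \<and> (\<forall>j\<in>set js. j \<ge> 1) \<and> sum_list js = k})"

definition M_rai :: "(real \<Rightarrow> nat \<Rightarrow> real) \<Rightarrow> bool" where
  "M_rai M \<longleftrightarrow> (\<forall>l>0. \<exists>l'>0. \<exists>H\<ge>1. \<forall>j k. 1 \<le> j \<and> j \<le> k \<longrightarrow>
     root j (check_seq (M l) j) \<le> H * root k (check_seq (M l') k))"

definition M_FdB :: "(real \<Rightarrow> nat \<Rightarrow> real) \<Rightarrow> bool" where
  "M_FdB M \<longleftrightarrow> (\<forall>l>0. \<exists>l'>0. \<exists>A>0. \<exists>B>0. \<forall>k.
     circ_seq (check_seq (M l)) k \<le> A * B ^ k * check_seq (M l') k)"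


section \<open>Sectors on the Riemann surface of the logarithm\<close>

text \<open>
  The Riemann surface of the logarithm is the universal covering \<open>exp : \<complex> \<rightarrow> \<complex> - {0}\<close>. A point is
  represented by its logarithm \<open>w = ln \<bar>z\<bar> + \<i> arg z\<close>, a global holomorphic chart; the coordinate
  \<open>z\<close> of the point is \<open>exp w\<close> and its argument (any real number) is \<open>Im w\<close>. Holomorphy of a function on
  (an open subset of) the surface is holomorphy in \<open>w\<close>.
\<close>

type_synonym log_surface = complex

definition sector :: "real \<Rightarrow> log_surface set" where
  "sector \<alpha> = {w. \<bar>Im w\<bar> < \<alpha> * pi / 2}"

text \<open>The derivative with respect to the coordinate \<open>z = exp w\<close>, i.e. \<open>d/dz = exp (-w) d/dw\<close>.\<close>

definition z_deriv :: "(log_surface \<Rightarrow> complex) \<Rightarrow> log_surface \<Rightarrow> complex" where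
  "z_deriv f w = deriv f w / exp w"

lemma z_deriv_tendsto:
  assumes "f holomorphic_on S" "open S" "w \<in> S"
  shows "((\<lambda>v. (f v - f w) / (exp v - exp w)) \<longlongrightarrow> z_deriv f w) (at w)"
proof -
  have 1: "((\<lambda>v. (f v - f w) / (v - w)) \<longlongrightarrow> deriv f w) (at w)"
    using holomorphic_derivI[OF assms] by (simp add: has_field_derivative_iff)
  have 2: "((\<lambda>v. (exp v - exp w) / (v - w)) \<longlongrightarrow> exp w) (at w)"
    using DERIV_exp[of w] by (simp add: has_field_derivative_iff)
  have "((\<lambda>v. ((f v - f w) / (v - w)) / ((exp v - exp w) / (v - w))) \<longlongrightarrow> z_deriv f w) (at w)"
    unfolding z_deriv_def by (intro tendsto_divide 1 2) simp
  moreover have "\<forall>\<^sub>F v in at w. ((f v - f w) / (v - w)) / ((exp v - exp w) / (v - w)) =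
      (f v - f w) / (exp v - exp w)"
    by (auto simp: eventually_at_filter)
  ultimately show ?thesis
    by (rule Lim_transform_eventually)
qed

lemma z_deriv_iterate_exp:
  assumes "f holomorphic_on S" "open S" "exp w \<in> S"
  shows "(z_deriv ^^ j) (\<lambda>v. f (exp v)) w = (deriv ^^ j) f (exp w)"
  using assms(3)
proof (induction j arbitrary: w)
  case (Suc j)
  have op: "open (exp -` S :: complex set)"
    by (intro open_vimage assms(2) continuous_intros)
  have "\<forall>\<^sub>F v in nhds w. v \<in> exp -` S"
    using op Suc.prems by (intro eventually_nhds_in_open) auto
  then have ev: "\<forall>\<^sub>F v in nhds w. (z_deriv ^^ j) (\<lambda>v. f (exp v)) v = (deriv ^^ j) f (exp v)"
    by (rule eventually_mono) (use Suc.IH in auto)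
  have "((deriv ^^ j) f has_field_derivative deriv ((deriv ^^ j) f) (exp w)) (at (exp w))"
    using holomorphic_higher_deriv[OF assms(1,2)] assms(2) Suc.prems
    by (intro holomorphic_derivI) auto
  then have "((\<lambda>v. (deriv ^^ j) f (exp v)) has_field_derivative
      deriv ((deriv ^^ j) f) (exp w) * exp w) (at w)"
    by (rule DERIV_chain2) (rule DERIV_exp)
  then have "deriv (\<lambda>v. (deriv ^^ j) f (exp v)) w = deriv ((deriv ^^ j) f) (exp w) * exp w"
    by (rule DERIV_imp_deriv)
  with deriv_cong_ev[OF ev refl] show ?case
    by (simp add: z_deriv_def[where w = w])
qed simp


section \<open>Ultraholomorphic classes and their stability properties\<close>

definition ultrahol_class :: "(real \<Rightarrow> real) \<Rightarrow> log_surface set \<Rightarrow> (log_surface \<Rightarrow> complex) set" where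
  "ultrahol_class \<omega> S = {f. f holomorphic_on S \<and>
     (\<exists>l>0. bdd_above ((\<lambda>(w, j). cmod ((z_deriv ^^ j) f w) / exp (1 / l * young_conj \<omega> (l * real j)))
                 ` (S \<times> UNIV)))}"

definition hol_matrix_class :: "(real \<Rightarrow> nat \<Rightarrow> real) \<Rightarrow> complex set \<Rightarrow> (complex \<Rightarrow> complex) set" where
  "hol_matrix_class M U = {g. g holomorphic_on U \<and>
     (\<forall>K. compact K \<and> K \<subseteq> U \<longrightarrow>
        (\<exists>l>0. \<exists>h>0. bdd_above ((\<lambda>(z, j). cmod ((deriv ^^ j) g z) / (h ^ j * M l j)) ` (K \<times> UNIV))))}"

definition holomorphically_closed :: "(real \<Rightarrow> real) \<Rightarrow> log_surface set \<Rightarrow> bool" where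
  "holomorphically_closed \<omega> S \<longleftrightarrow>
     (\<forall>f\<in>ultrahol_class \<omega> S. \<forall>U g. open U \<and> closure (f ` S) \<subseteq> U \<and> g holomorphic_on U \<longrightarrow>
        g \<circ> f \<in> ultrahol_class \<omega> S)"

definition inverse_closed :: "(real \<Rightarrow> real) \<Rightarrow> log_surface set \<Rightarrow> bool" where
  "inverse_closed \<omega> S \<longleftrightarrow>
     (\<forall>f\<in>ultrahol_class \<omega> S. (INF w\<in>S. cmod (f w)) > 0 \<longrightarrow>
        (\<lambda>w. 1 / f w) \<in> ultrahol_class \<omega> S)"

definition composition_closed :: "(real \<Rightarrow> real) \<Rightarrow> log_surface set \<Rightarrow> bool" where
  "composition_closed \<omega> S \<longleftrightarrow>
     (\<forall>f\<in>ultrahol_class \<omega> S. \<forall>U. open U \<and> closure (f ` S) \<subseteq> U \<longrightarrow>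
        (\<forall>g\<in>hol_matrix_class (weight_matrix \<omega>) U. g \<circ> f \<in> ultrahol_class \<omega> S))"

end

theory Submission
  imports Defs
begin

text \<open>
  Put \<open>\<phi> y = \<omega> (exp y)\<close>, so that \<open>W\<^sup>(\<^sup>l\<^sup>)\<^sub>j = sup\<^sub>y exp (j y - \<phi> y / l)\<close>. Condition \<open>(\<alpha>\<^sub>0)\<close> compares \<open>\<phi> (y + a)\<close> with
  \<open>exp a \<cdot> \<phi> y\<close>; under conjugation this is exactly the almost monotonicity of \<open>(W\<^sub>j / j!)\<^sup>1\<^sup>/\<^sup>j\<close>.
  The latter dominates the Taylor coefficients of \<open>f\<close> up to order \<open>k\<close> by a geometric sequence, and
  Cauchy estimates for \<open>g \<circ> P\<close>, with \<open>P\<close> the Taylor polynomial of \<open>f\<close>, bound the \<open>k\<close>-th derivative of \<open>g \<circ> f\<close>.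

  For the converse, \<open>(\<alpha>\<^sub>0)\<close> for \<open>\<omega>(t\<^sup>s)\<close> yields a superposition \<open>G\<close> of decreasing exponentials that is
  comparable to \<open>exp (- \<epsilon> \<omega>(t\<^sup>s))\<close> on closed subsectors of the right half plane. The Laplace transform
  \<open>f z = \<integral> exp (- z t) G (t\<^sup>1\<^sup>/\<^sup>s) dt\<close>, taken along a ray that turns with \<open>arg z\<close>, belongs to the class on
  \<open>S\<^sub>\<alpha>\<close> because \<open>\<alpha> < 1 + s\<close>, and \<open>(-1)\<^sup>j f\<^sup>(\<^sup>j\<^sup>)\<close> is positive and essentially maximal near the vertex. Hence
  the Taylor coefficients of \<open>1 / (b - f)\<close> involve no cancellation and dominate the powers
  \<open>(W\<^sub>j / j!)\<^sup>n\<close>, which gives back the almost monotonicity.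
\<close>

section \<open>The weight matrix and the condition \<open>(\<alpha>\<^sub>0)\<close>\<close>

lemma fact_ge_power_exp: "(real n / exp 1) ^ n \<le> fact n"
proof -
  have "real n ^ n / fact n \<le> exp (real n)"
  proof -
    have "(\<Sum>k\<in>{n}. real n ^ k /\<^sub>R fact k) \<le> (\<Sum>k. real n ^ k /\<^sub>R fact k)"
      by (intro sum_le_suminf summable_exp_generic) auto
    then show ?thesis
      by (simp add: exp_def divide_inverse mult.commute)
  qed
  then show ?thesis
    by (simp add: power_divide divide_simps exp_of_nat_mult[symmetric] mult.commute)
qed

lemma fact_le_power_self: "fact n \<le> real n ^ n"
  using fact_le_power[of n] by (metis of_nat_power of_nat_fact of_nat_le_iff order_refl)

lemma ln_fact_bounds:
  assumes "n \<ge> 1"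
  shows "ln (real n) - 1 \<le> ln (fact n) / real n" "ln (fact n) / real n \<le> ln (real n)"
proof -
  have n: "real n > 0" using assms by simp
  have "ln ((real n / exp 1) ^ n) \<le> ln (fact n)"
    using fact_ge_power_exp[of n] n by (subst ln_le_cancel_iff) auto
  then show "ln (real n) - 1 \<le> ln (fact n) / real n"
    using n by (simp add: ln_realpow ln_div field_simps)
  have "ln (fact n) \<le> ln (real n ^ n)"
    using fact_le_power_self[of n] n by (subst ln_le_cancel_iff) auto
  then show "ln (fact n) / real n \<le> ln (real n)"
    using n by (simp add: ln_realpow field_simps)
qed

section \<open>Young conjugate and elementary properties of the weight matrix\<close>

locale weight_W0 =
  fixes \<omega> :: "real \<Rightarrow> real"
  assumes weight_W0: "\<omega> \<in> weight_fun_W0"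
begin

definition phi :: "real \<Rightarrow> real" where
  "phi y = \<omega> (exp y)"

lemma phi_nonneg [simp]: "phi y \<ge> 0"
  using weight_W0 by (simp add: weight_fun_W0_def phi_def)

lemma phi_mono: "x \<le> y \<Longrightarrow> phi x \<le> phi y"
  using weight_W0 by (auto simp: weight_fun_W0_def phi_def intro: mono_onD)

lemma phi_nonpos: "y \<le> 0 \<Longrightarrow> phi y = 0"
  using weight_W0 by (auto simp: weight_fun_W0_def phi_def)

lemma phi_convex: "convex_on UNIV phi"
  using weight_W0 by (simp add: weight_fun_W0_def phi_def[abs_def])

text \<open>This is \<open>ln t = o(\<omega> t)\<close> read in the variable
  \<open>y = ln t\<close>. It makes the conjugate finite, and it later absorbs every linear error
  term in \<open>y\<close>.\<close>

lemma phi_superlinear: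
  assumes "c \<ge> 0"
  shows "\<exists>B\<ge>0. \<forall>y. c * y \<le> phi y + B"
proof (cases "c = 0")
  case False
  with assms have c: "c > 0" by simp
  have "(\<lambda>t. ln t) \<in> o[at_top](\<omega>)"
    using weight_W0 by (simp add: weight_fun_W0_def)
  then have "\<forall>\<^sub>F t in at_top. norm (ln t) \<le> (1/c) * norm (\<omega> t)"
    using c by (auto dest!: landau_o.smallD[where c = "1/c"])
  then obtain T where T: "\<And>t. t \<ge> T \<Longrightarrow> \<bar>ln t\<bar> \<le> (1/c) * \<bar>\<omega> t\<bar>"
    by (auto simp: eventually_at_top_linorder)
  define y0 where "y0 = ln (max T 1)"
  have "c * y \<le> phi y + c * \<bar>y0\<bar>" for y
  proof (cases "y \<ge> y0")
    case True
    have "exp y0 \<le> exp y" using True by simp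
    then have "T \<le> exp y" by (simp add: y0_def)
    from T[OF this] have "\<bar>y\<bar> \<le> (1/c) * phi y"
      using phi_nonneg[of y] by (simp add: phi_def)
    then have "c * \<bar>y\<bar> \<le> phi y" using c by (simp add: field_simps)
    moreover have "c * y \<le> c * \<bar>y\<bar>" "0 \<le> c * \<bar>y0\<bar>" using c by (auto intro!: mult_left_mono)
    ultimately show ?thesis by linarith
  next
    case False
    then have "c * y \<le> c * \<bar>y0\<bar>" using c by (intro mult_left_mono) auto
    then show ?thesis using phi_nonneg[of y] by linarith
  qed
  then show ?thesis using c by (intro exI[of _ "c * \<bar>y0\<bar>"]) auto
qed (auto intro!: exI[of _ 0])

text \<open>The supremum runs over \<open>y \<ge> 0\<close> only, but \<open>phi\<close> vanishes on
  the negative axis, where the linear term is at most its value at 0. Test points may therefore be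
  chosen without regard to sign.\<close>

lemma young_ge:
  assumes "x \<ge> 0"
  shows "x * y - phi y \<le> young_conj \<omega> x"
proof -
  obtain B where B: "\<And>y. x * y \<le> phi y + B"
    using phi_superlinear[OF assms] by blast
  have bdd: "bdd_above ((\<lambda>y. x * y - \<omega> (exp y)) ` {0..})"
    by (rule bdd_aboveI[of _ B]) (use B in \<open>auto simp: phi_def algebra_simps\<close>)
  have ge: "x * y - phi y \<le> young_conj \<omega> x" if "y \<ge> 0" for y
    unfolding young_conj_def phi_def using that by (intro cSUP_upper bdd) auto
  show ?thesis
  proof (cases "y \<ge> 0")
    case False
    then have "x * y \<le> 0" using assms by (simp add: mult_nonneg_nonpos)
    then show ?thesis using ge[of 0] phi_nonneg[of y] phi_nonpos[of 0] by linarith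
  qed (rule ge)
qed

lemma young_le:
  assumes "\<And>y. y \<ge> 0 \<Longrightarrow> x * y - phi y \<le> B"
  shows "young_conj \<omega> x \<le> B"
  unfolding young_conj_def using assms by (intro cSUP_least) (auto simp: phi_def)

text \<open>For \<open>j \<ge> 1\<close>, \<open>tau (l * real j)\<close> is the logarithm of the
  \<open>j\<close>-th root of \<open>W l j\<close>; it depends on the row and the index only through
  their product.\<close>

definition tau :: "real \<Rightarrow> real" where
  "tau x = young_conj \<omega> x / x"

lemma tau_ge: "x > 0 \<Longrightarrow> y - phi y / x \<le> tau x"
  using divide_right_mono[OF young_ge[of x y], of x] by (simp add: tau_def diff_divide_distrib)

lemma tau_le:
  assumes "x > 0" "\<And>y. y \<ge> 0 \<Longrightarrow> y - phi y / x \<le> B"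
  shows "tau x \<le> B"
proof -
  have "young_conj \<omega> x \<le> B * x"
    using assms by (intro young_le) (fastforce simp: field_simps)
  then show ?thesis using assms(1) by (simp add: tau_def field_simps)
qed

lemma tau_mono:
  assumes "0 < x" "x \<le> x'"
  shows "tau x \<le> tau x'"
proof (rule tau_le)
  fix y :: real
  have "phi y / x' \<le> phi y / x" using assms by (intro divide_left_mono) auto
  then show "y - phi y / x \<le> tau x'" using tau_ge[of x' y] assms by linarith
qed (use assms in auto)

lemma tau_nonneg: "x > 0 \<Longrightarrow> tau x \<ge> 0"
  using tau_ge[of x 0] phi_nonpos[of 0] by simp

abbreviation W :: "real \<Rightarrow> nat \<Rightarrow> real" where
  "W \<equiv> weight_matrix \<omega>"

lemma W_pos [simp]: "W l j > 0"
  by (simp add: weight_matrix_def)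

lemma W_eq_tau: "l > 0 \<Longrightarrow> W l j = exp (real j * tau (l * real j))"
  by (cases "j = 0") (use young_ge[of 0 0] young_le[of 0 0] phi_nonpos[of 0] in
      \<open>auto simp: weight_matrix_def tau_def field_simps\<close>)

lemma W_ge:
  assumes "l > 0"
  shows "exp (real j * y - phi y / l) \<le> W l j"
  using divide_right_mono[OF young_ge[of "l * real j" y], of l] assms
  by (simp add: weight_matrix_def diff_divide_distrib)

lemma W_le:
  assumes "l > 0" "\<And>y. y \<ge> 0 \<Longrightarrow> exp (real j * y - phi y / l) \<le> B"
  shows "W l j \<le> B"
proof -
  have B: "B > 0" using assms(2)[of 0] by (smt (verit) exp_gt_zero)
  have "young_conj \<omega> (l * real j) \<le> l * ln B"
  proof (rule young_le)
    fix y :: real assume "y \<ge> 0"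
    then have "real j * y - phi y / l \<le> ln B" using assms(2) B by (simp add: ln_ge_iff)
    then show "l * real j * y - phi y \<le> l * ln B" using assms(1) by (simp add: field_simps)
  qed
  then have "1 / l * young_conj \<omega> (l * real j) \<le> ln B" using assms(1) by (simp add: field_simps)
  then show ?thesis using B by (simp add: weight_matrix_def ln_ge_iff)
qed

lemma W_0 [simp]: "l > 0 \<Longrightarrow> W l 0 = 1"
  by (simp add: W_eq_tau)

lemma W_ge_1: "l > 0 \<Longrightarrow> W l j \<ge> 1"
  using W_ge[of l j 0] phi_nonpos[of 0] by simp

lemma W_mono_l:
  assumes "0 < l" "l \<le> l'"
  shows "W l j \<le> W l' j"
proof (rule W_le)
  fix y :: real
  have "phi y / l' \<le> phi y / l" using assms by (intro divide_left_mono) auto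
  then have "exp (real j * y - phi y / l) \<le> exp (real j * y - phi y / l')" by simp
  also have "\<dots> \<le> W l' j" using assms by (intro W_ge) auto
  finally show "exp (real j * y - phi y / l) \<le> W l' j" .
qed (use assms in auto)

text \<open>Splitting \<open>phi y / l\<close> into two equal halves gives each index its own half,
  so doubling the row parameter pays for additivity in the index.\<close>

lemma W_add:
  assumes "l > 0"
  shows "W l (j + k) \<le> W (2 * l) j * W (2 * l) k"
proof (rule W_le)
  fix y :: real
  have "exp (real (j + k) * y - phi y / l)
      = exp (real j * y - phi y / (2 * l)) * exp (real k * y - phi y / (2 * l))"
    using assms by (simp add: exp_add[symmetric] field_simps)
  also have "\<dots> \<le> W (2 * l) j * W (2 * l) k"
    using assms by (intro mult_mono W_ge) (auto intro: less_imp_le)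
  finally show "exp (real (j + k) * y - phi y / l) \<le> W (2 * l) j * W (2 * l) k" .
qed (use assms in auto)

text \<open>Logarithmic form of the root almost increasing property: since \<open>j/e \<le> (j!)\<^sup>1\<^sup>/\<^sup>j \<le> j\<close>,
  the factorials may be replaced by powers.\<close>

definition rai_log :: bool where
  "rai_log \<longleftrightarrow> (\<forall>l>0. \<exists>l'>0. \<exists>H\<ge>0. \<forall>j k. 1 \<le> j \<and> j \<le> k \<longrightarrow>
     tau (l * real j) - ln (real j) \<le> H + tau (l' * real k) - ln (real k))"

lemma root_check_eq:
  assumes "l > 0" "j \<ge> 1"
  shows "root j (check_seq (W l) j) = exp (tau (l * real j) - ln (fact j) / real j)"
proof -
  have "check_seq (W l) j = exp (real j * tau (l * real j) - ln (fact j))"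
    using assms by (simp add: check_seq_def W_eq_tau exp_diff)
  also have "\<dots> = exp (tau (l * real j) - ln (fact j) / real j) ^ j"
    using assms by (simp add: exp_of_nat_mult[symmetric] field_simps)
  finally show ?thesis using assms by (simp add: real_root_power_cancel)
qed

lemma M_rai_iff_rai_log: "M_rai W \<longleftrightarrow> rai_log"
proof
  assume rai: "M_rai W"
  show rai_log
    unfolding rai_log_def
  proof (intro allI impI)
    fix l :: real assume l: "l > 0"
    then obtain l' H where l': "l' > 0" "H \<ge> 1" and *: "\<And>j k. 1 \<le> j \<Longrightarrow> j \<le> k \<Longrightarrow>
       root j (check_seq (W l) j) \<le> H * root k (check_seq (W l') k)"
      using rai unfolding M_rai_def by meson
    show "\<exists>l'>0. \<exists>H\<ge>0. \<forall>j k. 1 \<le> j \<and> j \<le> k \<longrightarrow>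
       tau (l * real j) - ln (real j) \<le> H + tau (l' * real k) - ln (real k)"
    proof (rule exI[of _ l'], rule conjI[OF l'(1)], rule exI[of _ "ln H + 1"], intro conjI allI impI)
      fix j k :: nat assume jk: "1 \<le> j \<and> j \<le> k"
      have "exp (tau (l * real j) - ln (fact j) / real j)
          \<le> exp (ln H + (tau (l' * real k) - ln (fact k) / real k))"
        using *[of j k] jk l l' by (simp add: root_check_eq exp_add)
      then have "tau (l * real j) - ln (fact j) / real j
          \<le> ln H + (tau (l' * real k) - ln (fact k) / real k)" by simp
      with ln_fact_bounds(2)[of j] ln_fact_bounds(1)[of k] jk
      show "tau (l * real j) - ln (real j) \<le> ln H + 1 + tau (l' * real k) - ln (real k)"
        by linarith
    qed (use l' in auto)
  qed
next
  assume rai: rai_log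
  show "M_rai W"
    unfolding M_rai_def
  proof (intro allI impI)
    fix l :: real assume l: "l > 0"
    then obtain l' H where l': "l' > 0" "H \<ge> 0" and *: "\<And>j k. 1 \<le> j \<Longrightarrow> j \<le> k \<Longrightarrow>
       tau (l * real j) - ln (real j) \<le> H + tau (l' * real k) - ln (real k)"
      using rai unfolding rai_log_def by meson
    show "\<exists>l'>0. \<exists>H\<ge>1. \<forall>j k. 1 \<le> j \<and> j \<le> k \<longrightarrow>
       root j (check_seq (W l) j) \<le> H * root k (check_seq (W l') k)"
    proof (rule exI[of _ l'], rule conjI[OF l'(1)], rule exI[of _ "exp (H + 1)"], intro conjI allI impI)
      fix j k :: nat assume jk: "1 \<le> j \<and> j \<le> k"
      have "tau (l * real j) - ln (fact j) / real j
          \<le> H + 1 + (tau (l' * real k) - ln (fact k) / real k)"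
        using *[of j k] ln_fact_bounds(1)[of j] ln_fact_bounds(2)[of k] jk by linarith
      then have "exp (tau (l * real j) - ln (fact j) / real j)
          \<le> exp (H + 1 + (tau (l' * real k) - ln (fact k) / real k))" by simp
      then show "root j (check_seq (W l) j) \<le> exp (H + 1) * root k (check_seq (W l') k)"
        using jk l l' by (simp add: root_check_eq exp_add)
    qed (use l' in auto)
  qed
qed

text \<open>The hypothesis compares \<open>j\<close> only with its multiples. For general
  \<open>k\<close> the largest multiple \<open>m \<le> k\<close> of \<open>j\<close> is used:
  \<open>k < 2 * m\<close> costs \<open>ln 2\<close>, and \<open>tau\<close> is increasing.\<close>

lemma rai_log_if_power_bound:
  assumes "\<And>l. l > 0 \<Longrightarrow> \<exists>l'>0. \<exists>D\<ge>1. \<forall>j\<ge>1. \<forall>n\<ge>1.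
     check_seq (W l) j ^ n \<le> D ^ (j * n) * check_seq (W l') (j * n)"
  shows rai_log
  unfolding rai_log_def
proof (intro allI impI)
  fix l :: real assume l: "l > 0"
  then obtain l' D where l': "l' > 0" "D \<ge> 1" and *: "\<And>j n. 1 \<le> j \<Longrightarrow> 1 \<le> n \<Longrightarrow>
     check_seq (W l) j ^ n \<le> D ^ (j * n) * check_seq (W l') (j * n)"
    using assms by meson
  show "\<exists>l'>0. \<exists>H\<ge>0. \<forall>j k. 1 \<le> j \<and> j \<le> k \<longrightarrow>
       tau (l * real j) - ln (real j) \<le> H + tau (l' * real k) - ln (real k)"
  proof (rule exI[of _ l'], rule conjI[OF l'(1)], rule exI[of _ "ln D + 1 + ln 2"], intro conjI allI impI)
    fix j k :: nat assume jk: "1 \<le> j \<and> j \<le> k"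
    define n where "n = k div j"
    define m where "m = j * n"
    have n: "n \<ge> 1" using jk by (simp add: n_def Suc_le_eq div_greater_zero_iff)
    have m: "m \<ge> 1" "m \<le> k" using jk n by (auto simp: m_def n_def)
    have "k < 2 * m"
    proof -
      have "k = m + k mod j" by (simp add: m_def n_def)
      moreover have "k mod j < j" using jk by simp
      moreover have "j \<le> m" using n by (simp add: m_def)
      ultimately show ?thesis by linarith
    qed
    then have "ln (real k) \<le> ln (2 * real m)"
      using jk by (subst ln_le_cancel_iff) auto
    then have km: "ln (real k) \<le> ln 2 + ln (real m)" using m by (simp add: ln_mult)
    have "ln (check_seq (W l) j ^ n) \<le> ln (D ^ m * check_seq (W l') m)"
      using *[of j n] jk n l' by (subst ln_le_cancel_iff) (auto simp: m_def check_seq_def)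
    also have "ln (check_seq (W l) j ^ n) = real n * (real j * tau (l * real j) - ln (fact j))"
      using l jk by (simp add: check_seq_def W_eq_tau ln_realpow ln_div)
    also have "\<dots> = real m * (tau (l * real j) - ln (fact j) / real j)"
      using jk by (simp add: m_def field_simps)
    also have "ln (D ^ m * check_seq (W l') m) = real m * ln D + (real m * tau (l' * real m) - ln (fact m))"
      using l' m by (simp add: check_seq_def W_eq_tau ln_realpow ln_div ln_mult)
    also have "\<dots> = real m * (ln D + tau (l' * real m) - ln (fact m) / real m)"
      using m by (simp add: field_simps)
    finally have "tau (l * real j) - ln (fact j) / real j \<le> ln D + tau (l' * real m) - ln (fact m) / real m"
      using m by simp
    moreover have "tau (l' * real m) \<le> tau (l' * real k)"
      using l' m by (intro tau_mono) auto
    ultimately show "tau (l * real j) - ln (real j) \<le> ln D + 1 + ln 2 + tau (l' * real k) - ln (real k)"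
      using ln_fact_bounds(2)[of j] ln_fact_bounds(1)[of m] jk m km by linarith
  qed (use l' in auto)
qed

section \<open>The condition \<open>alpha0\<close> as a growth condition under translations of
  \<open>ln t\<close>, and its equivalence with almost monotonicity of roots\<close>

lemma alpha0_power_weightE:
  assumes "alpha0 (power_weight \<omega> s)"
  obtains C x0 where "C \<ge> 1" "x0 \<ge> 0"
    "\<And>a x. a \<ge> 0 \<Longrightarrow> x \<ge> x0 \<Longrightarrow> phi (s * (x + a)) \<le> C * exp a * phi (s * x)"
proof -
  obtain C t0 where C: "C \<ge> 1" and
      *: "\<And>k t. k \<ge> 1 \<Longrightarrow> t \<ge> t0 \<Longrightarrow> \<omega> ((k * t) powr s) \<le> C * k * \<omega> (t powr s)"
    using assms unfolding alpha0_def power_weight_def by blast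
  show ?thesis
  proof (rule that[of C "ln (max t0 1)"])
    fix a x :: real assume a: "a \<ge> 0" and x: "x \<ge> ln (max t0 1)"
    have "max t0 1 \<le> exp x" using x by (metis exp_le_cancel_iff exp_ln less_max_iff_disj zero_less_one)
    then have "\<omega> ((exp a * exp x) powr s) \<le> C * exp a * \<omega> (exp x powr s)"
      using a by (intro *) auto
    then show "phi (s * (x + a)) \<le> C * exp a * phi (s * x)"
      by (simp add: phi_def exp_add[symmetric] powr_def algebra_simps)
  qed (use C in auto)
qed

lemma alpha0_iff_power_weight_1: "alpha0 \<omega> \<longleftrightarrow> alpha0 (power_weight \<omega> 1)"
proof -
  have "(\<forall>t\<ge>t0. \<omega> (k * t) \<le> C * k * \<omega> t) \<longleftrightarrow>
      (\<forall>t\<ge>t0. \<omega> ((k * t) powr 1) \<le> C * k * \<omega> (t powr 1))"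
    if "k \<ge> 1" "t0 \<ge> 0" for k t0 C :: real using that by auto
  then show ?thesis
    unfolding alpha0_def power_weight_def by (meson order.trans)
qed

lemma alpha0E:
  assumes "alpha0 \<omega>"
  obtains C x0 where "C \<ge> 1" "x0 \<ge> 0"
    "\<And>a x. a \<ge> 0 \<Longrightarrow> x \<ge> x0 \<Longrightarrow> phi (x + a) \<le> C * exp a * phi x"
  using alpha0_power_weightE[of 1] assms unfolding alpha0_iff_power_weight_1 mult_1 by blast

lemma alpha0I:
  assumes "C \<ge> 0" "\<And>a x. a \<ge> 0 \<Longrightarrow> x \<ge> x0 \<Longrightarrow> phi (x + a) \<le> C * exp a * phi x"
  shows "alpha0 \<omega>"
  unfolding alpha0_def
proof (rule exI[of _ "max C 1"], rule conjI, simp, rule exI[of _ "exp x0"], intro conjI allI impI)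
  fix k t :: real assume k: "k \<ge> 1" and t: "t \<ge> exp x0"
  have t0: "t > 0" using t exp_gt_zero[of x0] by linarith
  have "phi (ln t + ln k) \<le> C * exp (ln k) * phi (ln t)"
    using k t t0 by (intro assms) (auto simp: ln_ge_iff)
  also have "\<dots> \<le> max C 1 * exp (ln k) * phi (ln t)"
    by (intro mult_right_mono) auto
  finally show "\<omega> (k * t) \<le> max C 1 * k * \<omega> t"
    using k t0 by (simp add: phi_def exp_add mult.commute)
qed auto

text \<open>A translation of \<open>y\<close> by a constant is a dilation of \<open>t\<close> by a
  constant factor, and replacing \<open>t\<close> by \<open>t powr s\<close> only rescales that
  constant; so any \<open>s > 0\<close> gives the same conclusion.\<close>

lemma phi_doubling:
  assumes "alpha0 (power_weight \<omega> s)" "s > 0"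
  shows "\<exists>C\<ge>1. \<forall>y. phi (y + a) \<le> C * phi y + C"
proof -
  obtain C x0 where C: "C \<ge> 1" "x0 \<ge> 0" and
    *: "\<And>a x. a \<ge> 0 \<Longrightarrow> x \<ge> x0 \<Longrightarrow> phi (s * (x + a)) \<le> C * exp a * phi (s * x)"
    using alpha0_power_weightE[OF assms(1)] by metis
  define b where "b = \<bar>a\<bar> / s"
  \<comment> \<open>The second summand covers \<open>y < s * x0\<close>, where \<open>alpha0\<close>
    says nothing and monotonicity of \<open>phi\<close> is used instead.\<close>
  define C' where "C' = C * exp b + phi (s * x0 + \<bar>a\<bar>)"
  have b: "b \<ge> 0" using assms by (simp add: b_def)
  have C1: "C * exp b \<ge> 1" using C b by (metis mult_mono' mult_1 one_le_exp_iff zero_le_one)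
  have "phi (y + a) \<le> C' * phi y + C'" for y
  proof (cases "y \<ge> s * x0")
    case True
    have "phi (y + a) \<le> phi (s * (y / s + b))"
      using assms by (intro phi_mono) (auto simp: b_def field_simps)
    also have "\<dots> \<le> C * exp b * phi (s * (y / s))"
      using True assms b by (intro *) (auto simp: field_simps)
    also have "\<dots> = C * exp b * phi y" using assms by simp
    also have "\<dots> \<le> C' * phi y" by (intro mult_right_mono) (auto simp: C'_def)
    also have "\<dots> \<le> C' * phi y + C'"
      using C1 phi_nonneg[of "s * x0 + \<bar>a\<bar>"] unfolding C'_def by linarith
    finally show ?thesis .
  next
    case False
    then have "phi (y + a) \<le> phi (s * x0 + \<bar>a\<bar>)" by (intro phi_mono) auto
    also have "\<dots> \<le> C'" using C1 by (simp add: C'_def)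
    also have "\<dots> \<le> C' * phi y + C'"
      using C1 phi_nonneg[of "s * x0 + \<bar>a\<bar>"] phi_nonneg[of y] unfolding C'_def by simp
    finally show ?thesis .
  qed
  moreover have "C' \<ge> 1" using C1 phi_nonneg[of "s * x0 + \<bar>a\<bar>"] unfolding C'_def by linarith
  ultimately show ?thesis by blast
qed

text \<open>The factor \<open>B ^ k\<close> translates \<open>y\<close> by \<open>ln B\<close> in
  the exponent, and \<open>phi_doubling\<close> turns this translation into a larger row parameter.
  Geometric factors in derivative bounds are therefore harmless.\<close>

lemma W_absorb_power:
  assumes "alpha0 (power_weight \<omega> s)" "s > 0" "l > 0" "B > 0"
  shows "\<exists>l'>0. \<exists>C>0. \<forall>k. B ^ k * W l k \<le> C * W l' k"
proof -
  obtain C where C: "C \<ge> 1" "\<And>y. phi (y + ln B) \<le> C * phi y + C"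
    using phi_doubling[OF assms(1,2)] by metis
  have "B ^ k * W l k \<le> exp (1 / l) * W (C * l) k" for k
  proof -
    have "W l k \<le> exp (1 / l) * W (C * l) k / B ^ k"
    proof (rule W_le)
      fix y :: real
      have "phi (y + ln B) / (C * l) \<le> (C * phi y + C) / (C * l)"
        using C assms by (intro divide_right_mono) auto
      also have "\<dots> = phi y / l + 1 / l" using C assms by (simp add: field_simps)
      finally have "real k * (y + ln B) - phi y / l \<le> 1 / l + (real k * (y + ln B) - phi (y + ln B) / (C * l))"
        by simp
      then have "exp (real k * (y + ln B) - phi y / l)
          \<le> exp (1 / l) * exp (real k * (y + ln B) - phi (y + ln B) / (C * l))"
        by (simp add: exp_add[symmetric])
      also have "\<dots> \<le> exp (1 / l) * W (C * l) k"
        using C assms by (intro mult_left_mono W_ge) auto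
      also have "exp (real k * (y + ln B) - phi y / l) = B ^ k * exp (real k * y - phi y / l)"
        using assms by (simp add: ring_distribs exp_add exp_diff exp_of_nat_mult)
      finally show "exp (real k * y - phi y / l) \<le> exp (1 / l) * W (C * l) k / B ^ k"
        using assms by (simp add: field_simps)
    qed (use assms in auto)
    then show ?thesis using assms by (simp add: field_simps)
  qed
  moreover have "C * l > 0" using C assms by simp
  ultimately show ?thesis by (metis exp_gt_zero)
qed

lemma alpha0_imp_rai_log:
  assumes "alpha0 \<omega>"
  shows rai_log
  unfolding rai_log_def
proof (intro allI impI)
  fix l :: real assume l: "l > 0"
  obtain C x0 where C: "C \<ge> 1" "x0 \<ge> 0" and
    *: "\<And>a x. a \<ge> 0 \<Longrightarrow> x \<ge> x0 \<Longrightarrow> phi (x + a) \<le> C * exp a * phi x"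
    using alpha0E[OF assms] by metis
  show "\<exists>l'>0. \<exists>H\<ge>0. \<forall>j k. 1 \<le> j \<and> j \<le> k \<longrightarrow>
       tau (l * real j) - ln (real j) \<le> H + tau (l' * real k) - ln (real k)"
  proof (rule exI[of _ "C * l"], rule conjI, use C l in simp, rule exI[of _ "phi x0 / l"], intro conjI allI impI)
    fix j k :: nat assume jk: "1 \<le> j \<and> j \<le> k"
    \<comment> \<open>Translating the test point \<open>y\<close> for index \<open>j\<close> by
      \<open>a\<close> gains exactly \<open>ln k - ln j\<close>, while the factor
      \<open>exp a = k / j\<close> from \<open>alpha0\<close> cancels in
      \<open>phi (y + a) / (C * l * k)\<close>.\<close>
    define a where "a = ln (real k / real j)"
    have pos: "real j > 0" "real k > 0" "real k / real j \<ge> 1" using jk by auto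
    have a: "a \<ge> 0" "exp a = real k / real j" "a = ln (real k) - ln (real j)"
    proof -
      show "a \<ge> 0" unfolding a_def using pos(3) by (rule ln_ge_zero)
      show "exp a = real k / real j" unfolding a_def using pos by (intro exp_ln) simp
      show "a = ln (real k) - ln (real j)" using pos unfolding a_def by (simp add: ln_div)
    qed
    have ge: "y - phi y / (l * real j) \<le> tau (C * l * real k) - a" if "y \<ge> x0" for y
    proof -
      have "phi (y + a) / (C * l * real k) \<le> C * exp a * phi y / (C * l * real k)"
        using C l by (intro divide_right_mono *) (auto simp: that a(1))
      also have "\<dots> = phi y / (l * real j)" using C l jk by (simp add: a(2) field_simps)
      finally show ?thesis using tau_ge[of "C * l * real k" "y + a"] C l jk by simp
    qed
    have H: "phi x0 / (l * real j) \<le> phi x0 / l" using l jk by (intro divide_left_mono) auto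
    have "tau (l * real j) \<le> phi x0 / l + tau (C * l * real k) - a"
    proof (rule tau_le)
      fix y :: real
      show "y - phi y / (l * real j) \<le> phi x0 / l + tau (C * l * real k) - a"
      proof (cases "y \<ge> x0")
        case True
        have "phi x0 / l \<ge> 0" using l by simp
        with ge[OF True] show ?thesis by linarith
      next
        \<comment> \<open>Below \<open>x0\<close> the value at \<open>y\<close> is compared with the
          one at \<open>x0\<close>, which costs at most \<open>phi x0 / l\<close>.\<close>
        case False
        moreover have "phi y / (l * real j) \<ge> 0" using l by simp
        ultimately show ?thesis using ge[of x0] H by linarith
      qed
    qed (use l jk in auto)
    then show "tau (l * real j) - ln (real j) \<le> phi x0 / l + tau (C * l * real k) - ln (real k)"
      using a by simp
  qed (use l C in auto)
qed

lemma support_line: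
  "\<exists>p\<ge>0. \<forall>z. phi z \<ge> phi y + p * (z - y)"
proof -
  \<comment> \<open>This is the right-hand derivative of \<open>phi\<close> at
    \<open>y\<close>.\<close>
  define p where "p = Inf ((\<lambda>t. (phi y - phi t) / (y - t)) ` ({y<..} \<inter> UNIV))"
  have *: "phi z \<ge> phi y + p * (z - y)" for z
    unfolding p_def by (rule convex_le_Inf_differential[OF phi_convex]) auto
  moreover have "p \<ge> 0" using *[of "y - 1"] phi_mono[of "y - 1" y] by simp
  ultimately show ?thesis by blast
qed

text \<open>A support line of slope \<open>p\<close> at \<open>Y = x + a\<close> shows that the
  supremum defining \<open>tau p\<close> is attained at \<open>Y\<close>, so a lower bound for
  \<open>tau p\<close> is an upper bound for \<open>phi Y\<close>. Such a bound comes from almost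
  monotonicity with \<open>k\<close> near \<open>p / l\<close> and \<open>j\<close> near
  \<open>k * exp (- a)\<close>: it gains \<open>a\<close>, and testing \<open>tau (real j)\<close>
  at \<open>x + H\<close> makes up for the loss \<open>H\<close>. What remains is
  \<open>p / j\<close> times \<open>phi (x + H)\<close>, and \<open>p / j\<close> is of size
  \<open>exp a\<close>.\<close>

lemma rai_log_imp_alpha0:
  assumes rai_log
  shows "alpha0 \<omega>"
proof -
  obtain l H where l: "l > 0" and H: "H \<ge> 0" and rai: "\<And>j k. 1 \<le> j \<Longrightarrow> j \<le> k \<Longrightarrow>
       tau (real j) - ln (real j) \<le> H + tau (l * real k) - ln (real k)"
    using assms unfolding rai_log_def by (metis mult_1 zero_less_one)
  \<comment> \<open>The additional \<open>x + H + 1\<close> comes from the boundary cases in which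
    the integer \<open>k\<close> or \<open>j\<close> above would be 0.\<close>
  have main: "phi (x + a) \<le> 4 * l * exp a * (phi (x + H) + x + H + 1)" if x: "x \<ge> 0" and a: "a \<ge> 0" for x a
  proof -
    define Y where "Y = x + a"
    have ea: "exp a \<ge> 1" "a \<le> exp a" using a exp_ge_add_one_self[of a] by (simp, linarith)
    obtain p where p: "p \<ge> 0" and supp: "\<And>z. phi z \<ge> phi Y + p * (z - Y)"
      using support_line by blast
    have phiY: "phi Y \<le> p * Y" using supp[of 0] phi_nonpos[of 0] by simp
    define S where "S = phi (x + H) + x + H + 1"
    have S: "x + 1 \<le> S" "x + H + 1 \<le> S" "phi (x + H) \<le> S" "0 \<le> S"
      using phi_nonneg[of "x + H"] x H by (auto simp: S_def simp del: phi_nonneg)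
    show ?thesis
      unfolding Y_def[symmetric] S_def[symmetric]
    proof (cases "p < l")
      case True
      have "phi Y \<le> p * Y" by (fact phiY)
      also have "\<dots> \<le> l * Y" using True x a by (intro mult_right_mono) (auto simp: Y_def)
      also have "Y \<le> exp a * (x + 1)"
        using ea x mult_right_mono[of 1 "exp a" x] by (simp add: Y_def ring_distribs)
      also have "l * (exp a * (x + 1)) \<le> l * (exp a * S)" using l S by simp
      also have "\<dots> \<le> 4 * l * exp a * S" using l S by simp
      finally show "phi Y \<le> 4 * l * exp a * S" using l by simp
    next
      case False
      define k where "k = nat \<lfloor>p / l\<rfloor>"
      have "p / l \<ge> 1" using False l by simp
      then have k1: "k \<ge> 1" and "real k \<le> p / l" "p / l < real k + 1"
        by (auto simp: k_def le_nat_floor of_nat_floor)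
      then have k: "l * real k \<le> p" "p \<le> 2 * l * real k"
      proof -
        show "l * real k \<le> p" using \<open>real k \<le> p / l\<close> l by (simp add: field_simps)
        have "p / l \<le> 2 * real k" using \<open>p / l < real k + 1\<close> k1 by simp
        then show "p \<le> 2 * l * real k" using l by (simp add: field_simps)
      qed
      have p0: "p > 0" using False l by simp
      have "tau p \<le> Y - phi Y / p"
      proof (rule tau_le[OF p0])
        fix y
        have "(phi Y + p * (y - Y)) / p \<le> phi y / p" using supp p0 by (intro divide_right_mono) auto
        then show "y - phi y / p \<le> Y - phi Y / p" using p0 by (simp add: field_simps)
      qed
      then have phiY2: "phi Y \<le> p * (Y - tau p)" using p0 by (simp add: field_simps)
      have tau_pk: "tau (l * real k) \<le> tau p" using k k1 l by (intro tau_mono) auto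
      show "phi Y \<le> 4 * l * exp a * S"
      proof (cases "real k \<ge> exp a")
        case True
        define j where "j = nat \<lfloor>real k / exp a\<rfloor>"
        have "real k / exp a \<ge> 1" using True by simp
        then have j1: "j \<ge> 1" and j2: "real j \<le> real k / exp a" and j3: "real k / exp a < real j + 1"
          by (auto simp: j_def le_nat_floor of_nat_floor)
        have j4: "real j * exp a \<le> real k" using j2 by (simp add: field_simps)
        have jk: "j \<le> k"
        proof -
          have "real j * 1 \<le> real j * exp a" using ea by (intro mult_left_mono) auto
          then show ?thesis using j4 by linarith
        qed
        have kj: "real k \<le> 2 * exp a * real j"
        proof -
          have "real k / exp a \<le> 2 * real j" using j1 j3 by simp
          then show ?thesis by (simp add: field_simps)
        qed
        have "ln (real j * exp a) \<le> ln (real k)"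
          using j4 j1 k1 by (subst ln_le_cancel_iff) auto
        then have "ln (real j) + a \<le> ln (real k)" using j1 by (simp add: ln_mult)
        then have "tau (real j) + a - H \<le> tau p" using rai[OF j1 jk] tau_pk by linarith
        moreover have "x + H - phi (x + H) / real j \<le> tau (real j)" using j1 by (intro tau_ge) auto
        ultimately have "Y - tau p \<le> phi (x + H) / real j" by (simp add: Y_def)
        then have "p * (Y - tau p) \<le> p * (phi (x + H) / real j)" using p0 by (intro mult_left_mono) auto
        also have "\<dots> \<le> (2 * l * real k) * (phi (x + H) / real j)" using k by (intro mult_right_mono) auto
        also have "\<dots> \<le> (2 * l * (2 * exp a * real j)) * (phi (x + H) / real j)"
          using kj l by (intro mult_right_mono mult_left_mono) auto
        also have "\<dots> = 4 * l * exp a * phi (x + H)" using j1 by simp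
        also have "\<dots> \<le> 4 * l * exp a * S" using S l by (intro mult_left_mono) auto
        finally show ?thesis using phiY2 by linarith
      next
        case False
        then have ka: "real k \<le> exp a" by simp
        \<comment> \<open>Now \<open>k * exp (- a)\<close> is too small to supply an index. Index 1
          with \<open>tau 1 \<ge> 0\<close> replaces it and leaves the term
          \<open>k * (a - ln k)\<close>, which \<open>ln u \<le> u - 1\<close> at
          \<open>u = exp a / k\<close> bounds by \<open>exp a\<close>.\<close>
        have "tau (real 1) - ln (real 1) \<le> H + tau (l * real k) - ln (real k)"
          using k1 by (intro rai) auto
        then have "ln (real k) - H \<le> tau p" using tau_nonneg[of 1] tau_pk by simp
        then have "p * (Y - tau p) \<le> p * (x + H + (a - ln (real k)))"
          using p0 by (intro mult_left_mono) (auto simp: Y_def)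
        also have "\<dots> \<le> (2 * l * real k) * (x + H + (a - ln (real k)))"
        proof (intro mult_right_mono k)
          have "ln (real k) \<le> a" using ka k1 by (metis ln_exp ln_le_cancel_iff exp_gt_zero of_nat_0_less_iff less_le_trans zero_less_one)
          then show "0 \<le> x + H + (a - ln (real k))" using x H by simp
        qed
        also have "\<dots> = 2 * l * (real k * (x + H) + real k * (a - ln (real k)))"
          by (simp add: algebra_simps)
        also have "\<dots> \<le> 2 * l * (exp a * (x + H) + exp a)"
        proof (intro mult_left_mono add_mono mult_right_mono ka)
          have "a - ln (real k) = ln (exp a / real k)" using k1 by (simp add: ln_div)
          also have "\<dots> \<le> exp a / real k - 1" using k1 by (intro ln_le_minus_one) auto
          also have "\<dots> \<le> exp a / real k" by simp
          finally show "real k * (a - ln (real k)) \<le> exp a" using k1 by (simp add: field_simps)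
        qed (use x H l in auto)
        also have "\<dots> = 2 * (l * (exp a * (x + H + 1)))" by (simp add: algebra_simps)
        also have "\<dots> \<le> 2 * (l * (exp a * S))" using S l by simp
        also have "\<dots> \<le> 4 * l * exp a * S" using S l by simp
        finally show ?thesis using phiY2 by linarith
      qed
    qed
  qed
  \<comment> \<open>For \<open>x \<ge> B + 1\<close> this yields \<open>x + 1 \<le> phi x\<close>,
    which removes the linear error. Applying \<open>main\<close> at \<open>x - H\<close> with the
    translation \<open>a + H\<close> removes the shift by \<open>H\<close>.\<close>
  obtain B where B: "B \<ge> 0" "\<And>y. 2 * y \<le> phi y + B" using phi_superlinear[of 2] by auto
  show ?thesis
  proof (rule alpha0I[of "8 * l * exp H" "B + 1 + H"])
    fix a x :: real assume a: "a \<ge> 0" and x: "x \<ge> B + 1 + H"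
    have "phi (x - H + (a + H)) \<le> 4 * l * exp (a + H) * (phi (x - H + H) + (x - H) + H + 1)"
      using a x B H by (intro main) auto
    also have "\<dots> = 4 * l * exp (a + H) * (phi x + (x + 1))" by simp
    also have "\<dots> \<le> 4 * l * exp (a + H) * (phi x + phi x)"
      using B(2)[of x] x l H by (intro mult_left_mono add_left_mono) auto
    finally show "phi (x + a) \<le> 8 * l * exp H * exp a * phi x"
      by (simp add: exp_add mult_ac)
  qed (use l in auto)
qed

end

section \<open>Stability of the classes\<close>

lemma eventually_analytic_at:
  fixes g :: "complex \<Rightarrow> complex"
  assumes "g analytic_on {x}"
  shows "\<forall>\<^sub>F w in nhds x. g analytic_on {w}"
proof -
  obtain S where "open S" "x \<in> S" "g holomorphic_on S"
    using assms by (auto simp: analytic_at)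
  then show ?thesis by (auto simp: eventually_nhds analytic_at)
qed

text \<open>By the chain rule and the Leibniz formula, order \<open>Suc k'\<close> of
  \<open>g \<circ> f\<close> involves only orders up to \<open>k'\<close> of
  \<open>deriv g \<circ> f\<close> and orders up to \<open>Suc k'\<close> of \<open>f\<close>. The
  outer function changes to \<open>deriv g\<close>, so the induction ranges over all
  \<open>g\<close>.\<close>

lemma higher_deriv_compose_cong:
  assumes "f1 analytic_on {z}" "f2 analytic_on {z}" "g analytic_on {f1 z}"
    and "\<And>j. j \<le> k \<Longrightarrow> (deriv ^^ j) f1 z = (deriv ^^ j) f2 z"
  shows "(deriv ^^ k) (g \<circ> f1) z = (deriv ^^ k) (g \<circ> f2) z"
  using assms(3,4)
proof (induction k arbitrary: g rule: less_induct)
  case (less k)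
  have eq: "f1 z = f2 z" using less.prems(2)[of 0] by simp
  show ?case
  proof (cases k)
    case 0 then show ?thesis by (simp add: eq)
  next
    case (Suc k')
    have expand: "(deriv ^^ Suc k') (g \<circ> f) z =
        (\<Sum>i = 0..k'. of_nat (k' choose i) * (deriv ^^ i) (deriv g \<circ> f) z * (deriv ^^ Suc (k' - i)) f z)"
      if f: "f analytic_on {z}" and g: "g analytic_on {f z}" for f
    proof -
      have "\<forall>\<^sub>F w in nhds (f z). g analytic_on {w}"
        using g by (rule eventually_analytic_at)
      then have "\<forall>\<^sub>F w in nhds z. g analytic_on {f w}"
        using analytic_at_imp_isCont[OF f] unfolding isCont_def tendsto_at_iff_tendsto_nhds
        by (rule eventually_compose_filterlim)
      moreover have "\<forall>\<^sub>F w in nhds z. f analytic_on {w}"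
        using f by (rule eventually_analytic_at)
      ultimately have "\<forall>\<^sub>F w in nhds z. deriv (g \<circ> f) w = (deriv g \<circ> f) w * deriv f w"
        by eventually_elim (auto simp: deriv_chain analytic_on_imp_differentiable_at)
      then have "(deriv ^^ Suc k') (g \<circ> f) z = (deriv ^^ k') (\<lambda>w. (deriv g \<circ> f) w * deriv f w) z"
        unfolding funpow_Suc_right comp_apply by (intro higher_deriv_cong_ev) auto
      also have "\<dots> = (\<Sum>i = 0..k'. of_nat (k' choose i) * (deriv ^^ i) (deriv g \<circ> f) z * (deriv ^^ (k' - i)) (deriv f) z)"
        using f g by (intro higher_deriv_mult_at analytic_deriv analytic_on_compose) auto
      finally show ?thesis by (simp add: funpow_Suc_right del: funpow.simps)
    qed
    have "(deriv ^^ i) (deriv g \<circ> f1) z = (deriv ^^ i) (deriv g \<circ> f2) z" if "i \<le> k'" for i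
      using that less.prems Suc by (intro less.IH analytic_deriv) auto
    moreover have "(deriv ^^ Suc (k' - i)) f1 z = (deriv ^^ Suc (k' - i)) f2 z" if "i \<le> k'" for i
      using that less.prems Suc by (intro less.prems(2)) auto
    ultimately show ?thesis
      unfolding Suc using assms(1,2) less.prems(1) eq by (simp only: expand cong: sum.cong_simp) (simp del: funpow.simps)
  qed
qed

lemma higher_deriv_taylor_poly:
  fixes a :: "nat \<Rightarrow> complex"
  shows "(deriv ^^ i) (\<lambda>w. \<Sum>j\<le>k. a j * (w - z) ^ j) z = (if i \<le> k then fact i * a i else 0)"
proof -
  have mono: "(deriv ^^ i) (\<lambda>w. a j * (w - z) ^ j) z = (if i = j then fact i * a i else 0)" for j
  proof -
    have "(deriv ^^ i) (\<lambda>w. a j * (w - z) ^ j) z = a j * (deriv ^^ i) (\<lambda>w. (w - z) ^ j) z"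
      by (intro higher_deriv_cmult' analytic_intros)
    then show ?thesis
      by (auto simp: higher_deriv_power pochhammer_fact[symmetric] pochhammer_0_left power_0_left)
  qed
  show ?thesis
  proof (induction k)
    case 0
    then show ?case using mono[of 0] by auto
  next
    case (Suc k)
    have "(deriv ^^ i) (\<lambda>w. (\<Sum>j\<le>k. a j * (w - z) ^ j) + a (Suc k) * (w - z) ^ Suc k) z =
        (deriv ^^ i) (\<lambda>w. \<Sum>j\<le>k. a j * (w - z) ^ j) z + (deriv ^^ i) (\<lambda>w. a (Suc k) * (w - z) ^ Suc k) z"
      by (intro higher_deriv_add_at analytic_intros)
    then show ?case using Suc mono[of "Suc k"] by auto
  qed
qed

text \<open>Replacing \<open>f\<close> by its Taylor polynomial of degree \<open>k\<close> turns the Faa di Bruno estimate into a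
  Cauchy estimate on a disc of radius \<open>d / (q (C + d))\<close>, on which the polynomial
  stays within \<open>d\<close> of \<open>f z\<close>.\<close>

lemma higher_deriv_compose_bound:
  assumes f: "f analytic_on {z}" and g: "g holomorphic_on U" "open U" and d: "d > 0" "cball (f z) d \<subseteq> U"
    and B: "\<And>v. v \<in> cball (f z) d \<Longrightarrow> norm (g v) \<le> B"
    and C: "C > 0" "q > 0"
    and bound: "\<And>j. 1 \<le> j \<Longrightarrow> j \<le> k \<Longrightarrow> norm ((deriv ^^ j) f z) \<le> C * q ^ j * fact j"
  shows "norm ((deriv ^^ k) (g \<circ> f) z) \<le> fact k * B * (q * (C + d) / d) ^ k"
proof -
  define a where "a j = (deriv ^^ j) f z / fact j" for j
  define P where "P w = (\<Sum>j\<le>k. a j * (w - z) ^ j)" for w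
  \<comment> \<open>Chosen so that \<open>q * r = d / (C + d)\<close>: the geometric series with
    first term \<open>C * (q * r)\<close> and ratio \<open>q * r\<close> then sums to exactly
    \<open>d\<close>.\<close>
  define r where "r = d / (q * (C + d))"
  have r: "r > 0" using d C by (simp add: r_def)
  have Pf: "(deriv ^^ j) P z = (deriv ^^ j) f z" if "j \<le> k" for j
    using that unfolding P_def by (subst higher_deriv_taylor_poly) (simp add: a_def)
  have Pz: "P z = f z" using Pf[of 0] by simp
  have P_bound: "P w \<in> cball (f z) d" if "w \<in> cball z r" for w
  proof -
    have w: "norm (w - z) \<le> r" using that by (simp add: dist_norm norm_minus_commute)
    define x where "x = q * r"
    have x: "x = d / (C + d)" "0 < x" "x < 1" using C d by (auto simp: x_def r_def)
    have "P w - P z = (\<Sum>j\<in>{1..k}. a j * (w - z) ^ j)"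
    proof -
      have "{..k} = insert 0 {1..k}" by auto
      then show ?thesis by (simp add: P_def power_0_left)
    qed
    then have "norm (P w - P z) \<le> (\<Sum>j\<in>{1..k}. norm (a j * (w - z) ^ j))"
      by (simp add: norm_sum)
    also have "\<dots> \<le> (\<Sum>j\<in>{1..k}. C * x ^ j)"
    proof (rule sum_mono)
      fix j assume j: "j \<in> {1..k}"
      then have "norm (a j) \<le> C * q ^ j"
        using bound[of j] by (simp add: a_def norm_divide field_simps)
      moreover have "norm ((w - z) ^ j) \<le> r ^ j" using w by (simp add: norm_power power_mono)
      ultimately have "norm (a j * (w - z) ^ j) \<le> (C * q ^ j) * r ^ j"
        unfolding norm_mult using C by (intro mult_mono) auto
      then show "norm (a j * (w - z) ^ j) \<le> C * x ^ j" by (simp add: x_def power_mult_distrib)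
    qed
    also have "\<dots> = C * (\<Sum>j\<in>{1..k}. x ^ j)" by (simp add: sum_distrib_left)
    also have "(\<Sum>j\<in>{1..k}. x ^ j) \<le> x / (1 - x)"
      using x(2,3) by (simp add: sum_gp divide_right_mono)
    also have "C * (x / (1 - x)) = d"
    proof -
      have "1 - x = C / (C + d)" using C d unfolding x(1) by (simp add: field_simps)
      then show ?thesis using C d unfolding x(1) by simp
    qed
    finally show ?thesis using C Pz by (simp add: dist_norm norm_minus_commute)
  qed
  have anP: "P analytic_on T" for T unfolding P_def by (intro analytic_intros)
  have ang: "g analytic_on U" using g by (simp add: analytic_on_open)
  have "(deriv ^^ k) (g \<circ> f) z = (deriv ^^ k) (g \<circ> P) z"
  proof (rule higher_deriv_compose_cong)
    show "g analytic_on {f z}" using ang by (rule analytic_on_subset) (use d in auto)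
  qed (use f anP Pf in auto)
  also have "norm \<dots> \<le> fact k * B / r ^ k"
  proof (rule Cauchy_inequality)
    have "g \<circ> P analytic_on cball z r"
      using P_bound d(2) by (intro analytic_on_compose anP analytic_on_subset[OF ang]) auto
    then have hol: "g \<circ> P holomorphic_on cball z r" by (rule analytic_imp_holomorphic)
    then show "continuous_on (cball z r) (g \<circ> P)" by (rule holomorphic_on_imp_continuous_on)
    show "g \<circ> P holomorphic_on ball z r" using hol by (rule holomorphic_on_subset) auto
    fix w assume "norm (z - w) = r"
    then show "norm ((g \<circ> P) w) \<le> B"
      using B[OF P_bound[of w]] by (simp add: dist_norm)
  qed (fact r)
  also have "\<dots> = fact k * B * (q * (C + d) / d) ^ k"
    by (simp add: r_def power_divide)
  finally show ?thesis .
qed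

section \<open>Local charts on the Riemann surface of the logarithm\<close>

lemma z_deriv_iterate_cong:
  assumes "\<forall>\<^sub>F v in nhds w. f v = g v"
  shows "\<forall>\<^sub>F v in nhds w. (z_deriv ^^ j) f v = (z_deriv ^^ j) g v"
proof (induction j)
  case (Suc j)
  then have "\<forall>\<^sub>F u in nhds w. \<forall>\<^sub>F v in nhds u. (z_deriv ^^ j) f v = (z_deriv ^^ j) g v"
    by (simp add: eventually_eventually)
  then show ?case
    by eventually_elim (auto simp: z_deriv_def[of "(z_deriv ^^ j) _"] intro!: arg_cong2[where f = "(/)"] deriv_cong_ev)
qed (use assms in simp)

lemma z_deriv_iterate_chart:
  assumes "F analytic_on {exp w}" "\<forall>\<^sub>F v in nhds w. f v = F (exp v)"
  shows "(z_deriv ^^ j) f w = (deriv ^^ j) F (exp w)"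
proof -
  obtain S where S: "open S" "exp w \<in> S" "F holomorphic_on S"
    using assms(1) by (auto simp: analytic_at)
  have "(z_deriv ^^ j) f w = (z_deriv ^^ j) (\<lambda>v. F (exp v)) w"
    using z_deriv_iterate_cong[OF assms(2)] by (rule eventually_nhds_x_imp_x)
  then show ?thesis using z_deriv_iterate_exp[OF S(3,1,2)] by simp
qed

text \<open>Near \<open>exp w\<close> the map \<open>z \<mapsto> w + Ln (z / exp w)\<close> is the
  branch of the logarithm with value \<open>w\<close> at \<open>exp w\<close>; it inverts
  \<open>exp\<close> as long as imaginary parts differ from \<open>Im w\<close> by less than
  \<open>pi\<close>. Iterated \<open>z_deriv\<close> thus become ordinary higher derivatives of a
  function in the plane.\<close>

lemma log_surface_chart:
  assumes "f holomorphic_on S" "open S" "w \<in> S"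
  obtains F where "F analytic_on {exp w}" "\<forall>\<^sub>F v in nhds w. f v = F (exp v)"
    "F (exp w) = f w" "\<And>j. (z_deriv ^^ j) f w = (deriv ^^ j) F (exp w)"
proof -
  define F where "F = f \<circ> (\<lambda>z. w + Ln (z / exp w))"
  have "(\<lambda>z. w + Ln (z / exp w)) analytic_on {exp w}"
    by (intro analytic_intros) auto
  moreover have "f analytic_on {w}" using assms by (auto simp: analytic_at)
  ultimately have F: "F analytic_on {exp w}" unfolding F_def by (intro analytic_on_compose) auto
  have "((\<lambda>v. Im (v - w)) \<longlongrightarrow> Im (w - w)) (nhds w)"
    by (intro tendsto_intros filterlim_ident)
  then have "\<forall>\<^sub>F v in nhds w. Im (v - w) < pi" "\<forall>\<^sub>F v in nhds w. Im (v - w) > - pi"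
    by (auto intro!: order_tendstoD)
  then have ev: "\<forall>\<^sub>F v in nhds w. f v = F (exp v)"
    by eventually_elim (simp add: F_def exp_diff[symmetric])
  from that[OF F ev _ z_deriv_iterate_chart[OF F ev]] show ?thesis
    using eventually_nhds_x_imp_x[OF ev] by simp
qed

lemma holomorphic_bounded_near_compact:
  assumes "g holomorphic_on U" "open U" "compact K" "K \<subseteq> U"
  obtains d B where "d > 0" "B > 0" "\<And>x. x \<in> K \<Longrightarrow> cball x d \<subseteq> U"
    "\<And>x v. x \<in> K \<Longrightarrow> v \<in> cball x d \<Longrightarrow> norm (g v) \<le> B"
proof -
  obtain e where e: "e > 0" "(\<Union>x\<in>K. ball x e) \<subseteq> U"
    using compact_subset_open_imp_ball_epsilon_subset[OF assms(3,2,4)] by blast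
  define K' where "K' = {x + y |x y. x \<in> K \<and> y \<in> cball 0 (e/2)}"
  have K': "compact K'" unfolding K'_def using assms by (intro compact_sums) auto
  have sub: "cball x (e/2) \<subseteq> K'" if "x \<in> K" for x
  proof
    fix v assume "v \<in> cball x (e/2)"
    then have "v = x + (v - x)" "v - x \<in> cball 0 (e/2)" by (auto simp: dist_norm norm_minus_commute)
    then show "v \<in> K'" using that unfolding K'_def by blast
  qed
  have "cball x (e/2) \<subseteq> ball x e" for x :: complex using e by auto
  moreover have "K' = (\<Union>x\<in>K. cball x (e/2))"
    using sub by (auto simp: K'_def dist_norm)
  ultimately have KU: "K' \<subseteq> U" using e(2) by blast
  have "compact (g ` K')"
    using holomorphic_on_imp_continuous_on[OF assms(1)] KU K'
    by (intro compact_continuous_image) (auto intro: continuous_on_subset)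
  then obtain B where "B > 0" "\<And>v. v \<in> K' \<Longrightarrow> norm (g v) \<le> B"
    using compact_imp_bounded bounded_pos[of "g ` K'"] by auto
  moreover have "cball x (e/2) \<subseteq> U" if "x \<in> K" for x using sub[OF that] KU by (rule subset_trans)
  moreover have "v \<in> K'" if "x \<in> K" "v \<in> cball x (e/2)" for x v using sub that by blast
  ultimately show ?thesis using e by (intro that[of "e/2" B]) auto
qed

lemma closure_avoids_zero:
  fixes f :: "complex \<Rightarrow> complex"
  assumes "(INF w\<in>S. cmod (f w)) > 0"
  shows "closure (f ` S) \<subseteq> - {0}"
proof -
  define m where "m = (INF w\<in>S. cmod (f w))"
  have "m \<le> cmod (f w)" if "w \<in> S" for w
    unfolding m_def using that by (intro cINF_lower) (auto intro: bdd_belowI[of _ 0])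
  then have "closure (f ` S) \<subseteq> {z. m \<le> cmod z}"
    by (intro closure_minimal closed_Collect_le continuous_intros) auto
  then show ?thesis using assms by (auto simp: m_def)
qed

text \<open>\<open>Max\<close> is informative only for a finite nonempty set. Positive entries with
  sum \<open>k\<close> are at most \<open>k\<close> and there are at most \<open>k\<close> of them,
  which gives finiteness; the list \<open>[k]\<close> gives nonemptiness.\<close>

lemma circ_seq_bounds:
  assumes "k \<ge> 1"
  shows circ_seq_ge: "length js \<ge> 1 \<Longrightarrow> \<forall>j\<in>set js. j \<ge> 1 \<Longrightarrow> sum_list js = k \<Longrightarrow>
      M (length js) * (\<Prod>j\<leftarrow>js. M j) \<le> circ_seq M k"
    and circ_seq_le: "(\<And>js. length js \<ge> 1 \<Longrightarrow> \<forall>j\<in>set js. j \<ge> 1 \<Longrightarrow> sum_list js = k \<Longrightarrow>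
      M (length js) * (\<Prod>j\<leftarrow>js. M j) \<le> B) \<Longrightarrow> circ_seq M k \<le> B"
proof -
  let ?T = "{M n * (\<Prod>j\<leftarrow>js. M j) | n js.
            n \<ge> 1 \<and> length js = n \<and> (\<forall>j\<in>set js. j \<ge> 1) \<and> sum_list js = k}"
  have len: "length js \<le> sum_list js" if "\<forall>j\<in>set js. (j::nat) \<ge> 1" for js
    using that by (induction js) auto
  have "?T \<subseteq> (\<lambda>js. M (length js) * (\<Prod>j\<leftarrow>js. M j)) ` {js. set js \<subseteq> {..k} \<and> length js \<le> k}"
  proof
    fix x assume "x \<in> ?T"
    then obtain js where js: "x = M (length js) * (\<Prod>j\<leftarrow>js. M j)" "\<forall>j\<in>set js. j \<ge> 1" "sum_list js = k"
      by auto
    have "set js \<subseteq> {..k}" using js(3) member_le_sum_list[of _ js] by auto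
    moreover have "length js \<le> k" using len[OF js(2)] js(3) by simp
    ultimately show "x \<in> (\<lambda>js. M (length js) * (\<Prod>j\<leftarrow>js. M j)) ` {js. set js \<subseteq> {..k} \<and> length js \<le> k}"
      using js(1) by (intro image_eqI[of _ _ js]) auto
  qed
  then have fin: "finite ?T" by (rule finite_subset) (intro finite_imageI finite_lists_length_le finite_atMost)
  have eq: "circ_seq M k = Max ?T" using assms by (simp add: circ_seq_def)
  have mem: "M (length js) * (\<Prod>j\<leftarrow>js. M j) \<in> ?T"
    if "length js \<ge> 1" "\<forall>j\<in>set js. j \<ge> 1" "sum_list js = k" for js
    by (rule CollectI, rule exI[of _ "length js"], rule exI[of _ js]) (use that in simp)
  have ne: "?T \<noteq> {}" using mem[of "[k]"] assms by auto
  show "M (length js) * (\<Prod>j\<leftarrow>js. M j) \<le> circ_seq M k"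
    if "length js \<ge> 1" "\<forall>j\<in>set js. j \<ge> 1" "sum_list js = k"
    unfolding eq by (rule Max_ge[OF fin mem[OF that]])
  show "circ_seq M k \<le> B" if B: "\<And>js. length js \<ge> 1 \<Longrightarrow> \<forall>j\<in>set js. j \<ge> 1 \<Longrightarrow> sum_list js = k \<Longrightarrow>
      M (length js) * (\<Prod>j\<leftarrow>js. M j) \<le> B"
    unfolding eq
  proof (rule Max.boundedI[OF fin ne])
    fix x assume "x \<in> ?T"
    then obtain js where js: "x = M (length js) * (\<Prod>j\<leftarrow>js. M j)" "length js \<ge> 1" "\<forall>j\<in>set js. j \<ge> 1" "sum_list js = k"
      by auto
    show "x \<le> B" unfolding js(1) by (rule B[OF js(2-4)])
  qed
qed

section \<open>Consequences of almost monotonicity, and the role of factorial lower bounds\<close>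

context weight_W0
begin

lemma ultrahol_class_iff:
  "f \<in> ultrahol_class \<omega> S \<longleftrightarrow> f holomorphic_on S \<and>
     (\<exists>l>0. \<exists>C>0. \<forall>w\<in>S. \<forall>j. cmod ((z_deriv ^^ j) f w) \<le> C * W l j)"
proof -
  have "bdd_above ((\<lambda>(w, j). cmod ((z_deriv ^^ j) f w) / exp (1 / l * young_conj \<omega> (l * real j))) ` (S \<times> UNIV))
      \<longleftrightarrow> (\<exists>C>0. \<forall>w\<in>S. \<forall>j. cmod ((z_deriv ^^ j) f w) \<le> C * W l j)" (is "?L = ?R") for l
  proof
    assume ?L
    then obtain C where C: "\<And>w j. w \<in> S \<Longrightarrow> cmod ((z_deriv ^^ j) f w) / W l j \<le> C"
      by (auto simp: bdd_above_def weight_matrix_def)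
    have "cmod ((z_deriv ^^ j) f w) \<le> max C 1 * W l j" if "w \<in> S" for w j
    proof -
      have "cmod ((z_deriv ^^ j) f w) / W l j \<le> max C 1" using C[OF that, of j] by simp
      then show ?thesis by (simp add: field_simps)
    qed
    then show ?R by (intro exI[of _ "max C 1"]) auto
  next
    assume ?R
    then obtain C where "\<And>w j. w \<in> S \<Longrightarrow> cmod ((z_deriv ^^ j) f w) \<le> C * W l j" by blast
    then show ?L
      by (auto intro!: bdd_aboveI[of _ C] simp: weight_matrix_def[symmetric] divide_simps)
         (auto simp: weight_matrix_def field_simps)
  qed
  then show ?thesis by (simp add: ultrahol_class_def)
qed

lemma ultrahol_classI:
  assumes "f holomorphic_on S" "l > 0" "C > 0"
    "\<And>w j. w \<in> S \<Longrightarrow> cmod ((z_deriv ^^ j) f w) \<le> C * W l j"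
  shows "f \<in> ultrahol_class \<omega> S"
  unfolding ultrahol_class_iff using assms by blast

text \<open>The number \<open>q\<close> depends on \<open>k\<close>: it is essentially the
  \<open>k\<close>-th root of \<open>W l' k / k!\<close>. Almost monotonicity makes the geometric
  sequence with ratio \<open>q\<close> dominate all earlier coefficients, with no essential loss at
  index \<open>k\<close> itself.\<close>

lemma rai_geometric_bound:
  assumes rai_log "l > 0"
  obtains l' D where "l' > 0" "D \<ge> 1"
    "\<And>k. k \<ge> 1 \<Longrightarrow> \<exists>q>0. (\<forall>j\<le>k. W l j \<le> q ^ j * fact j) \<and> q ^ k * fact k \<le> D ^ k * W l' k"
proof -
  obtain l' H where l': "l' > 0" "H \<ge> 0" and *: "\<And>j k. 1 \<le> j \<Longrightarrow> j \<le> k \<Longrightarrow>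
       tau (l * real j) - ln (real j) \<le> H + tau (l' * real k) - ln (real k)"
    using assms unfolding rai_log_def by meson
  show ?thesis
  proof (rule that[of l' "exp (1 + H)"])
    fix k :: nat assume k: "k \<ge> 1"
    \<comment> \<open>In the exponent, \<open>H\<close> is the almost-monotonicity constant and 1
      compensates the loss in \<open>(j / e) ^ j \<le> j!\<close>.\<close>
    define q where "q = exp (1 + H + tau (l' * real k)) / real k"
    have "W l j \<le> q ^ j * fact j" if "j \<le> k" for j
    proof (cases "j = 0")
      case False
      then have j: "j \<ge> 1" by simp
      have "W l j = exp (tau (l * real j)) ^ j" using assms by (simp add: W_eq_tau exp_of_nat_mult)
      also have "\<dots> \<le> exp (H + tau (l' * real k) - ln (real k) + ln (real j)) ^ j"
        using *[OF j that] by (intro power_mono) auto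
      also have "exp (H + tau (l' * real k) - ln (real k) + ln (real j)) = q * (real j / exp 1)"
        using j k by (simp add: q_def exp_add exp_diff field_simps)
      also have "(q * (real j / exp 1)) ^ j \<le> q ^ j * fact j"
        unfolding power_mult_distrib using k by (intro mult_left_mono fact_ge_power_exp) (auto simp: q_def)
      finally show ?thesis .
    qed (use assms in simp)
    moreover have "q ^ k * fact k \<le> exp (1 + H) ^ k * W l' k"
    proof -
      have "q ^ k * fact k \<le> q ^ k * real k ^ k"
        using k by (intro mult_left_mono fact_le_power_self) (auto simp: q_def)
      also have "\<dots> = (exp (1 + H) * exp (tau (l' * real k))) ^ k"
        using k by (simp add: q_def power_mult_distrib[symmetric] exp_add)
      also have "\<dots> = exp (1 + H) ^ k * W l' k"
        using l' by (simp add: power_mult_distrib W_eq_tau exp_of_nat_mult)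
      finally show ?thesis .
    qed
    ultimately show "\<exists>q>0. (\<forall>j\<le>k. W l j \<le> q ^ j * fact j) \<and> q ^ k * fact k \<le> exp (1 + H) ^ k * W l' k"
      using k by (intro exI[of _ q]) (auto simp: q_def)
  qed (use l' in auto)
qed

text \<open>The range of \<open>f\<close> is bounded, so its closure is compact and one radius
  \<open>d\<close> serves at all points. The geometric majorant is chosen anew for every order
  \<open>k\<close>, since only derivatives up to order \<open>k\<close> enter.\<close>

lemma rai_imp_holomorphically_closed:
  assumes rai: rai_log and S: "open S"
  shows "holomorphically_closed \<omega> S"
  unfolding holomorphically_closed_def
proof (intro ballI allI impI)
  fix f U g assume f: "f \<in> ultrahol_class \<omega> S" and "open U \<and> closure (f ` S) \<subseteq> U \<and> g holomorphic_on U"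
  then have U: "open U" "closure (f ` S) \<subseteq> U" "g holomorphic_on U" by auto
  obtain l C where l: "l > 0" and C: "C > 0" and holf: "f holomorphic_on S"
    and bound: "\<And>w j. w \<in> S \<Longrightarrow> cmod ((z_deriv ^^ j) f w) \<le> C * W l j"
    using f unfolding ultrahol_class_iff by blast
  have "bounded (f ` S)" using bound[of _ 0] l by (auto simp: bounded_iff)
  then have "compact (closure (f ` S))" by (simp add: compact_closure)
  then obtain d B where d: "d > 0" and B: "B > 0" and dU: "\<And>x. x \<in> closure (f ` S) \<Longrightarrow> cball x d \<subseteq> U"
    and gB: "\<And>x v. x \<in> closure (f ` S) \<Longrightarrow> v \<in> cball x d \<Longrightarrow> norm (g v) \<le> B"
    using holomorphic_bounded_near_compact[OF U(3,1) _ U(2), of thesis] by blast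
  obtain l' D where l': "l' > 0" and D: "D \<ge> 1" and
    q: "\<And>k. k \<ge> 1 \<Longrightarrow> \<exists>q>0. (\<forall>j\<le>k. W l j \<le> q ^ j * fact j) \<and> q ^ k * fact k \<le> D ^ k * W l' k"
    using rai_geometric_bound[OF rai l] by metis
  define E where "E = D * ((C + d) / d)"
  have E: "E > 0" using D C d by (simp add: E_def)
  have fS: "f w \<in> closure (f ` S)" if "w \<in> S" for w using that closure_subset[of "f ` S"] by auto
  have main: "cmod ((z_deriv ^^ k) (g \<circ> f) w) \<le> B * (E ^ k * W l' k)" if w: "w \<in> S" for w k
  proof (cases "k = 0")
    case True
    then show ?thesis using gB[OF fS[OF w], of "f w"] d l' by simp
  next
    case False
    then obtain q where q: "q > 0" "\<And>j. j \<le> k \<Longrightarrow> W l j \<le> q ^ j * fact j" "q ^ k * fact k \<le> D ^ k * W l' k"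
      using q[of k] by auto
    obtain F where F: "F analytic_on {exp w}" "\<forall>\<^sub>F v in nhds w. f v = F (exp v)"
      "F (exp w) = f w" "\<And>j. (z_deriv ^^ j) f w = (deriv ^^ j) F (exp w)"
      using log_surface_chart[OF holf S w, of thesis] by blast
    have fw: "f w \<in> U" using dU[OF fS[OF w]] d by auto
    have "(z_deriv ^^ k) (g \<circ> f) w = (deriv ^^ k) (g \<circ> F) (exp w)"
    proof (rule z_deriv_iterate_chart)
      show "g \<circ> F analytic_on {exp w}"
        using F(1,3) U(1,3) fw by (intro analytic_on_compose) (auto simp: analytic_at)
      show "\<forall>\<^sub>F v in nhds w. (g \<circ> f) v = (g \<circ> F) (exp v)"
        using F(2) by eventually_elim simp
    qed
    also have "cmod \<dots> \<le> fact k * B * (q * (C + d) / d) ^ k"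
    proof (rule higher_deriv_compose_bound[OF F(1) U(3,1) d _ _ C q(1)])
      show "cball (F (exp w)) d \<subseteq> U" using dU fS w F(3) by auto
      show "norm (g v) \<le> B" if "v \<in> cball (F (exp w)) d" for v using gB fS w F(3) that by auto
      fix j assume j: "1 \<le> j" "j \<le> k"
      have "norm ((deriv ^^ j) F (exp w)) \<le> C * W l j" using bound[OF w, of j] F(4) by simp
      also have "\<dots> \<le> C * (q ^ j * fact j)" using q(2) j C by simp
      finally show "norm ((deriv ^^ j) F (exp w)) \<le> C * q ^ j * fact j" by simp
    qed
    also have "\<dots> = B * ((q ^ k * fact k) * ((C + d) / d) ^ k)"
      by (simp add: power_mult_distrib power_divide)
    also have "\<dots> \<le> B * ((D ^ k * W l' k) * ((C + d) / d) ^ k)"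
      using B C d by (intro mult_left_mono mult_right_mono q) auto
    also have "\<dots> = B * (E ^ k * W l' k)" unfolding E_def power_mult_distrib[of D] by (simp only: ac_simps)
    finally show ?thesis .
  qed
  \<comment> \<open>Almost monotonicity itself supplies the condition that allows the remaining
    factor \<open>E ^ k\<close> to be absorbed into a larger row.\<close>
  have "alpha0 (power_weight \<omega> 1)"
    using rai_log_imp_alpha0[OF rai] alpha0_iff_power_weight_1 by simp
  from W_absorb_power[OF this _ l' E] obtain l'' C' where l'': "l'' > 0" "C' > 0"
    "\<And>k. E ^ k * W l' k \<le> C' * W l'' k" by auto
  show "g \<circ> f \<in> ultrahol_class \<omega> S"
    unfolding ultrahol_class_iff
  proof (intro conjI)
    show "g \<circ> f holomorphic_on S"
      using holf U fS dU d by (intro holomorphic_on_compose) (auto intro: holomorphic_on_subset)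
    have "cmod ((z_deriv ^^ k) (g \<circ> f) w) \<le> (B * C') * W l'' k" if "w \<in> S" for w k
      using order_trans[OF main[OF that, of k] mult_left_mono[OF l''(3)[of k], of B]] B
      by (simp only: mult.assoc less_imp_le)
    then show "\<exists>l>0. \<exists>C>0. \<forall>w\<in>S. \<forall>j. cmod ((z_deriv ^^ j) (g \<circ> f) w) \<le> C * W l j"
      using l'' B by (meson mult_pos_pos)
  qed
qed

lemma holomorphically_closed_imp_inverse_closed:
  assumes "holomorphically_closed \<omega> S"
  shows "inverse_closed \<omega> S"
  unfolding inverse_closed_def
proof (intro ballI impI)
  fix f assume f: "f \<in> ultrahol_class \<omega> S" and inf: "(INF w\<in>S. cmod (f w)) > 0"
  have "(\<lambda>z. 1 / z) holomorphic_on - {0::complex}" by (intro holomorphic_intros) auto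
  then have "(\<lambda>z. 1 / z) \<circ> f \<in> ultrahol_class \<omega> S"
    using assms f closure_avoids_zero[OF inf] unfolding holomorphically_closed_def
    by (metis open_Compl closed_singleton)
  then show "(\<lambda>w. 1 / f w) \<in> ultrahol_class \<omega> S" by (simp add: o_def)
qed

lemma holomorphically_closed_imp_composition_closed:
  assumes "holomorphically_closed \<omega> S"
  shows "composition_closed \<omega> S"
  using assms unfolding holomorphically_closed_def composition_closed_def hol_matrix_class_def
  by blast

text \<open>At most linear growth of \<open>\<omega>\<close> bounds \<open>phi y\<close> by a
  multiple of \<open>exp y\<close> plus a constant; testing the supremum at \<open>y = ln j\<close>
  then produces \<open>j ^ j\<close> up to a geometric factor.\<close>

lemma W_ge_fact:
  assumes "\<omega> \<in> O[at_top](\<lambda>t. t)" "l > 0"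
  obtains c h where "c > 0" "h > 0" "\<And>j. c * h ^ j * fact j \<le> W l j"
proof -
  obtain A where A: "A > 0" "\<forall>\<^sub>F t in at_top. norm (\<omega> t) \<le> A * norm t"
    using assms(1) by (elim landau_o.bigE) auto
  then obtain T where T: "\<And>t. t \<ge> T \<Longrightarrow> \<bar>\<omega> t\<bar> \<le> A * \<bar>t\<bar>"
    by (auto simp: eventually_at_top_linorder)
  define x where "x = ln (max T 1)"
  have phi: "phi y \<le> A * exp y + phi x" for y
  proof (cases "y \<ge> x")
    case True
    have "exp x \<le> exp y" using True by simp
    then have "T \<le> exp y" by (simp add: x_def)
    from T[OF this] show ?thesis using phi_nonneg[of x] by (simp add: phi_def)
  next
    case False
    then have "phi y \<le> phi x" by (intro phi_mono) auto
    moreover have "A * exp y \<ge> 0" using A by simp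
    ultimately show ?thesis by linarith
  qed
  show ?thesis
  proof (rule that[of "exp (- phi x / l)" "exp (- A / l)"])
    fix j :: nat
    show "exp (- phi x / l) * exp (- A / l) ^ j * fact j \<le> W l j"
    proof (cases "j = 0")
      case False
      have "exp (- phi x / l) * exp (- A / l) ^ j * fact j \<le> exp (- phi x / l) * exp (- A / l) ^ j * real j ^ j"
        by (intro mult_left_mono fact_le_power_self) auto
      also have "\<dots> = exp (- phi x / l) * exp (- A / l) ^ j * exp (ln (real j)) ^ j"
        using False by simp
      also have "\<dots> = exp (real j * ln (real j) - (A * exp (ln (real j)) + phi x) / l)"
        using False by (simp add: exp_of_nat_mult[symmetric] exp_add[symmetric] add_divide_distrib del: exp_ln)
          (simp add: algebra_simps)
      also have "\<dots> \<le> exp (real j * ln (real j) - phi (ln (real j)) / l)"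
        using phi[of "ln (real j)"] assms(2) by (simp add: divide_right_mono)
      also have "\<dots> \<le> W l j" using assms(2) by (rule W_ge)
      finally show ?thesis .
    qed (use assms in simp)
  qed auto
qed

text \<open>Cauchy's inequality bounds the derivatives by \<open>j! / d ^ j\<close>, and the matrix
  dominates factorials. The point is that \<open>1 / z\<close> becomes an admissible outer
  function.\<close>

lemma holomorphic_imp_hol_matrix_class:
  assumes "\<omega> \<in> O[at_top](\<lambda>t. t)" "g holomorphic_on U" "open U"
  shows "g \<in> hol_matrix_class W U"
  unfolding hol_matrix_class_def
proof (intro CollectI conjI allI impI assms(2))
  fix K assume K: "compact K \<and> K \<subseteq> U"
  then obtain d B where d: "d > 0" and B: "B > 0" and dU: "\<And>x. x \<in> K \<Longrightarrow> cball x d \<subseteq> U"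
    and gB: "\<And>x v. x \<in> K \<Longrightarrow> v \<in> cball x d \<Longrightarrow> norm (g v) \<le> B"
    using holomorphic_bounded_near_compact[OF assms(2,3), of K thesis] by blast
  obtain c h where c: "c > 0" "h > 0" "\<And>j. c * h ^ j * fact j \<le> W 1 j"
    using W_ge_fact[OF assms(1), of 1 thesis] by auto
  have "cmod ((deriv ^^ j) g z) / ((1 / (d * h)) ^ j * W 1 j) \<le> B / c" if z: "z \<in> K" for z j
  proof -
    have hol: "g holomorphic_on cball z d" using dU[OF z] assms(2) by (rule holomorphic_on_subset[rotated])
    have "cmod ((deriv ^^ j) g z) \<le> fact j * B / d ^ j"
      using hol d gB[OF z]
      by (intro Cauchy_inequality)
         (auto intro: holomorphic_on_imp_continuous_on holomorphic_on_subset simp: dist_norm)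
    also have "\<dots> = (c * h ^ j * fact j) * ((1 / (d * h)) ^ j * (B / c))"
      using c d by (simp add: power_divide power_mult_distrib)
    also have "\<dots> \<le> W 1 j * ((1 / (d * h)) ^ j * (B / c))"
      using c d B by (intro mult_right_mono c) auto
    also have "\<dots> = (B / c) * ((1 / (d * h)) ^ j * W 1 j)" by simp
    finally show ?thesis using c d by (subst pos_divide_le_eq) auto
  qed
  then show "\<exists>l>0. \<exists>h>0. bdd_above ((\<lambda>(z, j). cmod ((deriv ^^ j) g z) / (h ^ j * W l j)) ` (K \<times> UNIV))"
    using c d by (intro exI[of _ "1::real"] conjI exI[of _ "1 / (d * h)"] bdd_aboveI[of _ "B / c"]) auto
qed

lemma composition_closed_imp_inverse_closed:
  assumes "composition_closed \<omega> S" "\<omega> \<in> O[at_top](\<lambda>t. t)"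
  shows "inverse_closed \<omega> S"
  unfolding inverse_closed_def
proof (intro ballI impI)
  fix f assume f: "f \<in> ultrahol_class \<omega> S" and inf: "(INF w\<in>S. cmod (f w)) > 0"
  have "(\<lambda>z. 1 / z) holomorphic_on - {0::complex}" by (intro holomorphic_intros) auto
  then have "(\<lambda>z. 1 / z) \<in> hol_matrix_class W (- {0})"
    using assms(2) by (intro holomorphic_imp_hol_matrix_class) auto
  then have "(\<lambda>z. 1 / z) \<circ> f \<in> ultrahol_class \<omega> S"
    using assms(1) f closure_avoids_zero[OF inf] unfolding composition_closed_def
    by (metis open_Compl closed_singleton)
  then show "(\<lambda>w. 1 / f w) \<in> ultrahol_class \<omega> S" by (simp add: o_def)
qed

lemma W_shift:
  assumes "l > 0" "j \<ge> 1"
  shows "check_seq (W l) j \<le> W (2 * l) 1 * check_seq (W (2 * l)) (j - 1)"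
proof -
  obtain i where j: "j = Suc i" using assms(2) by (cases j) auto
  have "check_seq (W l) j \<le> W l j / fact i"
    unfolding check_seq_def j by (intro divide_left_mono fact_mono) (auto intro: less_imp_le)
  also have "\<dots> \<le> W (2 * l) 1 * W (2 * l) i / fact i"
    using W_add[OF assms(1), of 1 i] by (intro divide_right_mono) (auto simp: j)
  finally show ?thesis by (simp add: check_seq_def j)
qed

text \<open>Lowering each index \<open>j\<^sub>i\<close> by one makes the indices \<open>n, j\<^sub>1 - 1, \<dots>, j\<^sub>n - 1\<close> sum up to \<open>k\<close>.\<close>

lemma rai_imp_FdB:
  assumes rai_log
  shows "M_FdB W"
  unfolding M_FdB_def
proof (intro allI impI)
  fix l :: real assume l: "l > 0"
  define c where "c = W (2 * l) 1"
  have c: "c \<ge> 1" using l by (simp add: c_def W_ge_1)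
  obtain l' D where l': "l' > 0" and D: "D \<ge> 1" and
    q: "\<And>k. k \<ge> 1 \<Longrightarrow> \<exists>q>0. (\<forall>j\<le>k. W (2 * l) j \<le> q ^ j * fact j) \<and> q ^ k * fact k \<le> D ^ k * W l' k"
    using rai_geometric_bound[OF assms, of "2 * l" thesis] l by auto
  have "circ_seq (check_seq (W l)) k \<le> 1 * (c * D) ^ k * check_seq (W l') k" for k
  proof (cases "k = 0")
    case True
    then show ?thesis using l' by (simp add: circ_seq_def check_seq_def)
  next
    case False
    then have k: "k \<ge> 1" by simp
    then obtain q where q0: "q > 0" and q1: "\<And>j. j \<le> k \<Longrightarrow> W (2 * l) j \<le> q ^ j * fact j"
      and q2: "q ^ k * fact k \<le> D ^ k * W l' k"
      using q by meson
    have qc: "check_seq (W (2 * l)) j \<le> q ^ j" if "j \<le> k" for j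
      using q1[OF that] by (simp add: check_seq_def field_simps)
    have nonneg: "check_seq (W l) j \<ge> 0" for l j by (simp add: check_seq_def less_imp_le)
    \<comment> \<open>Lowering each index by one loses one factor \<open>q\<close> per entry. The
      missing \<open>q ^ length js\<close> is supplied by the outer factor, whose index is
      \<open>length js\<close>.\<close>
    have prod: "(\<Prod>j\<leftarrow>js. check_seq (W l) j) * q ^ length js \<le> c ^ length js * q ^ sum_list js"
      if "\<forall>j\<in>set js. 1 \<le> j \<and> j \<le> k" for js
      using that
    proof (induction js)
      case (Cons j js)
      have "check_seq (W l) j * q \<le> (c * check_seq (W (2 * l)) (j - 1)) * q"
        using W_shift[OF l, of j] Cons.prems q0 by (intro mult_right_mono) (auto simp: c_def)
      also have "\<dots> \<le> (c * q ^ (j - 1)) * q"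
        using Cons.prems c q0 by (intro mult_right_mono mult_left_mono qc) auto
      also have "\<dots> = c * q ^ j" using Cons.prems by (cases j) auto
      finally have "check_seq (W l) j * q * ((\<Prod>j\<leftarrow>js. check_seq (W l) j) * q ^ length js)
          \<le> c * q ^ j * (c ^ length js * q ^ sum_list js)"
        using Cons.IH Cons.prems q0 c
        by (rule_tac mult_mono) (auto intro!: mult_nonneg_nonneg prod_list_nonneg nonneg)
      then show ?case by (simp add: power_add mult_ac)
    qed simp
    show ?thesis
    proof (rule circ_seq_le[OF k])
      fix js assume js: "length js \<ge> 1" "\<forall>j\<in>set js. j \<ge> 1" "sum_list js = k"
      have le: "\<forall>j\<in>set js. 1 \<le> j \<and> j \<le> k" using js member_le_sum_list[of _ js] by auto
      have len: "length js \<le> k" using js(2,3)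
      proof (induction js arbitrary: k)
        case (Cons j js)
        then have "length js \<le> sum_list js" by auto
        then show ?case using Cons.prems by auto
      qed simp
      have "check_seq (W l) (length js) \<le> check_seq (W (2 * l)) (length js)"
        using l unfolding check_seq_def by (intro divide_right_mono W_mono_l) auto
      also have "\<dots> \<le> q ^ length js" by (rule qc[OF len])
      finally have "check_seq (W l) (length js) * (\<Prod>j\<leftarrow>js. check_seq (W l) j)
          \<le> q ^ length js * (\<Prod>j\<leftarrow>js. check_seq (W l) j)"
        by (intro mult_right_mono prod_list_nonneg) (auto intro: nonneg)
      also have "\<dots> \<le> c ^ length js * q ^ k" using prod[OF le] js(3) by (simp add: mult.commute)
      also have "\<dots> \<le> c ^ k * q ^ k" using c len q0 by (intro mult_right_mono power_increasing) auto
      also have "\<dots> \<le> c ^ k * (D ^ k * W l' k / fact k)"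
        using q2 c by (intro mult_left_mono) (auto simp: field_simps)
      also have "\<dots> = 1 * (c * D) ^ k * check_seq (W l') k" by (simp add: check_seq_def power_mult_distrib)
      finally show "check_seq (W l) (length js) * (\<Prod>j\<leftarrow>js. check_seq (W l) j)
          \<le> 1 * (c * D) ^ k * check_seq (W l') k" .
    qed
  qed
  then show "\<exists>l'>0. \<exists>A>0. \<exists>B>0. \<forall>k. circ_seq (check_seq (W l)) k \<le> A * B ^ k * check_seq (W l') k"
    using l' c D by (meson zero_less_one less_le_trans mult_pos_pos)
qed

lemma FdB_imp_rai_log:
  assumes "M_FdB W" "\<omega> \<in> O[at_top](\<lambda>t. t)"
  shows rai_log
proof (rule rai_log_if_power_bound)
  fix l :: real assume l: "l > 0"
  obtain l' A B where l': "l' > 0" and A: "A > 0" and B: "B > 0" and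
    FdB: "\<And>k. circ_seq (check_seq (W l)) k \<le> A * B ^ k * check_seq (W l') k"
    using assms(1) l unfolding M_FdB_def by meson
  obtain c h where c: "c > 0" "h > 0" "\<And>j. c * h ^ j * fact j \<le> W l j"
    using W_ge_fact[OF assms(2) l, of thesis] by blast
  \<comment> \<open>Each constant is raised to at least 1, so that its exponent may be increased to
    \<open>j * n\<close>.\<close>
  define D where "D = max 1 (A / c) * max 1 B * max 1 (1 / h)"
  have "check_seq (W l) j ^ n \<le> D ^ (j * n) * check_seq (W l') (j * n)" if "j \<ge> 1" "n \<ge> 1" for j n
  proof -
    have jn: "j * n \<ge> 1" "n \<le> j * n" using that by auto
    have "c * h ^ n * check_seq (W l) j ^ n \<le> check_seq (W l) n * check_seq (W l) j ^ n"
      using c(3)[of n] by (intro mult_right_mono) (auto simp: check_seq_def field_simps less_imp_le)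
    also have "\<dots> \<le> circ_seq (check_seq (W l)) (j * n)"
      using circ_seq_ge[OF jn(1), of "replicate n j" "check_seq (W l)"] that
      by (simp add: sum_list_replicate mult.commute)
    also have "\<dots> \<le> A * B ^ (j * n) * check_seq (W l') (j * n)" by (rule FdB)
    finally have "check_seq (W l) j ^ n \<le> A / c * B ^ (j * n) * (1 / h) ^ n * check_seq (W l') (j * n)"
      using c by (simp add: field_simps)
    also have "\<dots> \<le> max 1 (A / c) ^ (j * n) * max 1 B ^ (j * n) * max 1 (1 / h) ^ (j * n) * check_seq (W l') (j * n)"
    proof (intro mult_right_mono mult_mono)
      show "A / c \<le> max 1 (A / c) ^ (j * n)"
        using jn by (meson max.cobounded1 max.cobounded2 order_trans self_le_power zero_less_one less_le_trans)
      show "(1 / h) ^ n \<le> max 1 (1 / h) ^ (j * n)"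
        using power_mono[of "1 / h" "max 1 (1 / h)" n] power_increasing[OF jn(2), of "max 1 (1 / h)"] c by simp
      show "B ^ (j * n) \<le> max 1 B ^ (j * n)" using B by (intro power_mono) auto
    qed (use A B c in \<open>auto simp: check_seq_def less_imp_le\<close>)
    also have "\<dots> = D ^ (j * n) * check_seq (W l') (j * n)" by (simp add: D_def power_mult_distrib)
    finally show ?thesis .
  qed
  moreover have "D \<ge> 1" unfolding D_def by (intro mult_ge1_I) auto
  ultimately show "\<exists>l'>0. \<exists>D\<ge>1. \<forall>j\<ge>1. \<forall>n\<ge>1. check_seq (W l) j ^ n \<le> D ^ (j * n) * check_seq (W l') (j * n)"
    using l' by blast
qed

end

section \<open>Characteristic functions on sectors\<close>

lemma open_Im_strip: "open {z. \<bar>Im z\<bar> < c}"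
proof -
  have "open ((\<lambda>z. \<bar>Im z\<bar>) -` {..<c})" by (intro open_vimage continuous_intros open_lessThan)
  then show ?thesis by (simp add: vimage_def)
qed

lemma open_sector: "open (sector \<alpha>)"
  unfolding sector_def by (rule open_Im_strip)

section \<open>Improper integrals depending on a parameter\<close>

lemma uniform_limit_imp_holomorphic:
  assumes "open S" "\<And>n. f n holomorphic_on S" "uniform_limit S f g sequentially"
  shows "g holomorphic_on S"
proof (rule holomorphic_uniform_sequence[OF assms(1,2)])
  fix x assume "x \<in> S"
  then obtain d where "d > 0" "cball x d \<subseteq> S" using assms(1) open_contains_cball by blast
  then show "\<exists>d>0. cball x d \<subseteq> S \<and> uniform_limit (cball x d) f g sequentially"
    using uniform_limit_on_subset[OF assms(3)] by blast
qed

lemma exp_minus_abs_le: "exp (- \<bar>x\<bar>) \<le> 2 / (1 + x\<^sup>2)" for x :: real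
proof -
  have "1 + x\<^sup>2 \<le> 2 * exp \<bar>x\<bar>"
    using exp_lower_Taylor_quadratic[of "\<bar>x\<bar>"] by simp
  then show ?thesis by (simp add: exp_minus field_simps add_pos_nonneg)
qed

text \<open>The majorant \<open>2 / (1 + (x - m)\<^sup>2)\<close> has an arctangent as
  antiderivative, so the bound depends neither on the interval nor on the centre
  \<open>m\<close>.\<close>

lemma norm_integral_le_pi:
  fixes f :: "real \<Rightarrow> complex"
  assumes "continuous_on UNIV f" "\<And>x. norm (f x) \<le> M * exp (- \<bar>x - m\<bar>)" "M \<ge> 0" "a \<le> b"
  shows "norm (integral {a..b} f) \<le> 2 * pi * M"
proof -
  have int: "((\<lambda>x. 2 * M / (1 + (x - m)\<^sup>2)) has_integral (2 * M * arctan (b - m) - 2 * M * arctan (a - m))) {a..b}"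
    using assms(4)
    by (intro fundamental_theorem_of_calculus)
       (auto intro!: derivative_eq_intros simp: has_real_derivative_iff_has_vector_derivative[symmetric] field_simps add_nonneg_eq_0_iff)
  have "norm (integral {a..b} f) \<le> integral {a..b} (\<lambda>x. 2 * M / (1 + (x - m)\<^sup>2))"
  proof (rule integral_norm_bound_integral)
    show "f integrable_on {a..b}"
      using assms(1) by (intro integrable_continuous_real) (auto intro: continuous_on_subset)
    show "(\<lambda>x. 2 * M / (1 + (x - m)\<^sup>2)) integrable_on {a..b}" using int by blast
    fix x
    have "norm (f x) \<le> M * exp (- \<bar>x - m\<bar>)" by (rule assms(2))
    also have "\<dots> \<le> M * (2 / (1 + (x - m)\<^sup>2))"
      using assms(3) by (intro mult_left_mono exp_minus_abs_le)
    finally show "norm (f x) \<le> 2 * M / (1 + (x - m)\<^sup>2)" by (simp add: mult.commute)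
  qed
  also have "\<dots> = 2 * M * (arctan (b - m) - arctan (a - m))"
    using int by (simp add: integral_unique right_diff_distrib)
  also have "\<dots> \<le> 2 * M * pi"
    using arctan_bounded[of "b - m"] arctan_bounded[of "a - m"] assms(3) by (intro mult_left_mono) auto
  finally show ?thesis by (simp only: mult_ac)
qed

text \<open>The integral is summed over the shells between \<open>n\<close> and \<open>n + 1\<close>
  on both sides; each contributes at most \<open>2 * M * exp (- n)\<close>, whatever
  \<open>w\<close> is.\<close>

lemma uniform_limit_improper_integral:
  fixes k :: "complex \<Rightarrow> real \<Rightarrow> complex"
  assumes "\<And>w. w \<in> S \<Longrightarrow> continuous_on UNIV (k w)"
    "\<And>w x. w \<in> S \<Longrightarrow> norm (k w x) \<le> M * exp (- \<bar>x\<bar>)"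
  shows "\<exists>J. uniform_limit S (\<lambda>n w. integral {- real n..real n} (k w)) J sequentially"
proof -
  define p where "p n w = integral {- real (Suc n)..- real n} (k w) + integral {real n..real (Suc n)} (k w)" for n w
  have int: "k w integrable_on {a..b}" if "w \<in> S" for w a b
    using assms(1)[OF that] by (intro integrable_continuous_real) (auto intro: continuous_on_subset)
  have sum_p: "(\<Sum>i<n. p i w) = integral {- real n..real n} (k w)" if w: "w \<in> S" for n w
  proof (induction n)
    case (Suc n)
    have 1: "integral {- real (Suc n)..- real n} (k w) + integral {- real n..real n} (k w) = integral {- real (Suc n)..real n} (k w)"
      by (rule Henstock_Kurzweil_Integration.integral_combine) (auto intro: int[OF w])
    have 2: "integral {- real (Suc n)..real n} (k w) + integral {real n..real (Suc n)} (k w) = integral {- real (Suc n)..real (Suc n)} (k w)"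
      by (rule Henstock_Kurzweil_Integration.integral_combine) (auto intro: int[OF w])
    show ?case
      unfolding sum.lessThan_Suc Suc unfolding p_def 2[symmetric] 1[symmetric] by (simp only: ac_simps)
  qed simp
  have "uniform_limit S (\<lambda>n w. \<Sum>i<n. p i w) (\<lambda>w. suminf (\<lambda>i. p i w)) sequentially"
  proof (rule Weierstrass_m_test)
    fix n w assume w: "w \<in> S"
    have M: "M \<ge> 0"
      using order_trans[OF norm_ge_zero assms(2)[OF w, of 0]] by simp
    have *: "norm (integral {a..a+1} (k w)) \<le> M * exp (- real n)" if "\<And>x. x \<in> {a..a+1} \<Longrightarrow> \<bar>x\<bar> \<ge> real n" for a
    proof -
      have "norm (integral {a..a+1} (k w)) \<le> integral {a..a+1} (\<lambda>_. M * exp (- real n))"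
      proof (rule integral_norm_bound_integral)
        fix x assume "x \<in> {a..a+1}"
        then have "M * exp (- \<bar>x\<bar>) \<le> M * exp (- real n)" using that M by (intro mult_left_mono) auto
        with assms(2)[OF w, of x] show "norm (k w x) \<le> M * exp (- real n)" by linarith
      qed (use int[OF w] in auto)
      then show ?thesis by simp
    qed
    have "norm (p n w) \<le> norm (integral {- real (Suc n)..- real n} (k w)) + norm (integral {real n..real (Suc n)} (k w))"
      unfolding p_def by (rule norm_triangle_ineq)
    also have "\<dots> \<le> M * exp (- real n) + M * exp (- real n)"
      using *[of "- real (Suc n)"] *[of "real n"] by (intro add_mono) (auto simp: add.commute)
    also have "\<dots> = 2 * M * exp (- 1) ^ n" by (simp add: exp_of_nat_mult[symmetric])
    finally show "norm (p n w) \<le> 2 * M * exp (- 1) ^ n" .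
  qed (auto intro!: summable_mult summable_geometric)
  then have "uniform_limit S (\<lambda>n w. integral {- real n..real n} (k w)) (\<lambda>w. suminf (\<lambda>i. p i w)) sequentially"
    using sum_p by (subst (asm) uniform_limit_cong') auto
  then show ?thesis by blast
qed

section \<open>Laplace transforms along rays turning with the argument\<close>

locale contour_kernel =
  fixes g :: "complex \<Rightarrow> complex" and s \<alpha> A :: real and \<Phi> :: "real \<Rightarrow> real"
  assumes s: "s > 0" and \<alpha>: "0 < \<alpha>" "\<alpha> < 1 + s"
    and g_hol: "g holomorphic_on {z. \<bar>Im z\<bar> < pi / 2}"
    and A: "A > 0"
    and g_bound: "\<And>z. \<bar>Im z\<bar> \<le> \<alpha> / (1 + s) * pi / 2 \<Longrightarrow> norm (g z) \<le> A * exp (- \<Phi> (s * Re z))"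
    and M_ex: "\<And>j::nat. \<exists>M>0. \<forall>y. exp (real (j + 1) * y - \<Phi> y) \<le> M * exp (- \<bar>y\<bar>)"
begin

text \<open>With \<open>z = exp w\<close> and \<open>t = exp (x - s * w / (1 + s))\<close> this is
  \<open>(- t) ^ j * exp (- z * t) * g (ln t / s)\<close> times \<open>dt / dx = t\<close>, whence
  the exponent \<open>j + 1\<close>. The arguments of \<open>z * t\<close> and of
  \<open>exp (ln t / s)\<close> are \<open>Im w / (1 + s)\<close> and its negative.\<close>

definition kern :: "nat \<Rightarrow> complex \<Rightarrow> real \<Rightarrow> complex" where
  "kern j w x = (- 1) ^ j * exp (- exp (of_real x + w / of_real (1 + s))) *
     g (of_real (x / s) - w / of_real (1 + s)) *
     exp (of_nat (j + 1) * (of_real x - of_real (s / (1 + s)) * w))"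

definition J :: "nat \<Rightarrow> complex \<Rightarrow> complex" where
  "J j w = lim (\<lambda>n. integral {- real n..real n} (kern j w))"

lemma sector_strip:
  assumes "w \<in> sector \<alpha>"
  shows "\<bar>Im (of_real x - w / of_real (1 + s))\<bar> \<le> \<alpha> / (1 + s) * pi / 2"
    "\<bar>Im (of_real x - w / of_real (1 + s))\<bar> < pi / 2"
    "\<bar>Im (of_real x + w / of_real (1 + s))\<bar> < pi / 2"
proof -
  have eq: "Im (w / of_real (1 + s)) = Im w / (1 + s)"
    by (simp only: Im_divide_of_real)
  have "\<bar>Im w / (1 + s)\<bar> = \<bar>Im w\<bar> / (1 + s)" using s by simp
  also have "\<dots> \<le> (\<alpha> * pi / 2) / (1 + s)"
    using assms s unfolding sector_def by (intro divide_right_mono) auto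
  also have "\<dots> = \<alpha> / (1 + s) * pi / 2" using s by (simp add: field_simps)
  finally have 1: "\<bar>Im w / (1 + s)\<bar> \<le> \<alpha> / (1 + s) * pi / 2" .
  have "\<alpha> / (1 + s) < 1" using \<alpha> s by simp
  moreover have "q * pi / 2 < pi / 2" if "q < 1" for q using that by simp
  ultimately have 2: "\<alpha> / (1 + s) * pi / 2 < pi / 2" by blast
  show "\<bar>Im (of_real x - w / of_real (1 + s))\<bar> \<le> \<alpha> / (1 + s) * pi / 2"
    "\<bar>Im (of_real x - w / of_real (1 + s))\<bar> < pi / 2"
    "\<bar>Im (of_real x + w / of_real (1 + s))\<bar> < pi / 2"
    using 1 2 unfolding minus_complex.sel plus_complex.sel eq Im_complex_of_real by linarith+
qed

lemma convex_sector: "convex (sector \<alpha>)"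
proof -
  have "sector \<alpha> = {z. Im z < \<alpha> * pi / 2} \<inter> {z. Im z > - (\<alpha> * pi / 2)}"
    by (auto simp: sector_def)
  then show ?thesis
    by (simp only: convex_Int convex_halfspace_Im_lt convex_halfspace_Im_gt)
qed

lemma norm_kern_le:
  assumes "w \<in> sector \<alpha>"
  shows "norm (kern j w x) \<le> A * exp (real (j + 1) * (x - s / (1 + s) * Re w) - \<Phi> (x - s / (1 + s) * Re w))"
proof -
  define y where "y = x - s / (1 + s) * Re w"
  have "cos (Im (of_real x + w / of_real (1 + s))) > 0"
    using sector_strip(3)[OF assms, of x] by (intro cos_gt_zero_pi) linarith+
  then have "Re (exp (of_real x + w / of_real (1 + s))) \<ge> 0"
    unfolding Re_exp by (intro mult_nonneg_nonneg) auto
  then have 1: "norm (exp (- exp (of_real x + w / of_real (1 + s)))) \<le> 1" by simp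
  have "Re (of_real (x / s) - w / of_real (1 + s)) = x / s - Re w / (1 + s)"
    by (simp only: minus_complex.sel Re_complex_of_real Re_divide_of_real)
  then have "s * Re (of_real (x / s) - w / of_real (1 + s)) = y"
    using s by (simp only: y_def right_diff_distrib) simp
  then have 2: "norm (g (of_real (x / s) - w / of_real (1 + s))) \<le> A * exp (- \<Phi> y)"
    using g_bound[OF sector_strip(1)[OF assms, of "x / s"]] by simp
  have 3: "norm (exp (of_nat (j + 1) * (of_real x - of_real (s / (1 + s)) * w))) = exp (real (j + 1) * y)"
    unfolding norm_exp_eq_Re y_def by simp
  have "norm (kern j w x) \<le> 1 * (A * exp (- \<Phi> y)) * exp (real (j + 1) * y)"
    unfolding kern_def norm_mult 3 norm_power
    using 1 2 A by (intro mult_right_mono mult_mono) auto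
  also have "1 * (A * exp (- \<Phi> y)) * exp (real (j + 1) * y) = A * exp (real (j + 1) * y - \<Phi> y)"
    by (simp add: exp_diff exp_minus field_simps)
  finally show ?thesis unfolding y_def .
qed

definition kern_dx :: "nat \<Rightarrow> complex \<Rightarrow> real \<Rightarrow> complex" where
  "kern_dx j w x = (- 1) ^ j * exp (- exp (of_real x + w / of_real (1 + s))) *
     (- exp (of_real x + w / of_real (1 + s)) * g (of_real (x / s) - w / of_real (1 + s))
       + deriv g (of_real (x / s) - w / of_real (1 + s)) / of_real s
       + of_nat (j + 1) * g (of_real (x / s) - w / of_real (1 + s))) *
     exp (of_nat (j + 1) * (of_real x - of_real (s / (1 + s)) * w))"

lemma g_deriv:
  assumes "\<bar>Im z\<bar> < pi / 2"
  shows "(g has_field_derivative deriv g z) (at z)"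
  using assms by (intro holomorphic_derivI[OF g_hol open_Im_strip]) auto

lemma has_vector_derivative_kern:
  assumes w: "w \<in> sector \<alpha>"
  shows "(kern j w has_vector_derivative kern_dx j w x) (at x)"
proof -
  have "((\<lambda>z. (- 1) ^ j * exp (- exp (z + w / of_real (1 + s))) *
     g (z / of_real s - w / of_real (1 + s)) *
     exp (of_nat (j + 1) * (z - of_real (s / (1 + s)) * w))) has_field_derivative kern_dx j w x) (at (of_real x))"
    using s sector_strip(2)[OF w, of "x / s"] unfolding kern_dx_def
    by (auto intro!: derivative_eq_intros DERIV_chain2[OF g_deriv] simp: algebra_simps)
  then have "((\<lambda>x. (- 1) ^ j * exp (- exp (of_real x + w / of_real (1 + s))) *
     g (of_real x / of_real s - w / of_real (1 + s)) *
     exp (of_nat (j + 1) * (of_real x - of_real (s / (1 + s)) * w))) has_vector_derivative kern_dx j w x) (at x)"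
    by (rule has_vector_derivative_real_field)
  then show ?thesis by (simp add: kern_def[abs_def])
qed

text \<open>The shift of the contour by \<open>- s w / (1 + s)\<close> contributes an exact \<open>x\<close>-derivative.\<close>

lemma has_field_derivative_kern:
  assumes w: "w \<in> sector \<alpha>"
  shows "((\<lambda>w. kern j w x) has_field_derivative
     exp w * kern (Suc j) w x - of_real (s / (1 + s)) * kern_dx j w x) (at w within T)"
proof -
  define r where "r = complex_of_real (1 + s)"
  define u where "u = complex_of_real s"
  have r: "r \<noteq> 0" "r = 1 + u" "u \<noteq> 0" using s by (auto simp: r_def u_def complex_eq_iff)
  define Ef where "Ef w = exp (of_real x + w / r)" for w
  define Pf where "Pf w = g (of_real (x / s) - w / r)" for w
  define Qf where "Qf w = exp (of_nat (j + 1) * (of_real x - u / r * w))" for w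
  define E where "E = Ef w"
  define P where "P = Pf w"
  define P' where "P' = deriv g (of_real (x / s) - w / r)"
  define Q where "Q = Qf w"
  \<comment> \<open>In terms of \<open>z\<close> and \<open>t\<close> this reads
    \<open>z * t ^ (j + 2) = (z * t) * t ^ (j + 1)\<close>.\<close>
  have EQ: "exp w * exp (of_nat (Suc j + 1) * (of_real x - u / r * w)) = E * Q"
  proof -
    define t where "t = w / r"
    have t: "u / r * w = u * t" "w = t + u * t"
    proof -
      have "r * t = w" using r(1) by (simp add: t_def)
      then show "w = t + u * t" by (simp add: r(2) algebra_simps)
    qed (simp add: t_def)
    have "w + of_nat (Suc j + 1) * (of_real x - u * t) = (of_real x + t) + of_nat (j + 1) * (of_real x - u * t)"
      by (subst t(2)) (simp add: algebra_simps)
    then have "w + of_nat (Suc j + 1) * (of_real x - u / r * w) = (of_real x + w / r) + of_nat (j + 1) * (of_real x - u / r * w)"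
      unfolding t(1) t_def[symmetric] .
    then show ?thesis unfolding E_def Q_def Ef_def Qf_def by (simp only: exp_add[symmetric])
  qed
  have sr: "of_real (s / (1 + s)) = u / r" by (simp add: u_def r_def)
  have dE: "(Ef has_field_derivative E / r) (at w)"
    unfolding Ef_def[abs_def] E_def using r(1) by (auto intro!: derivative_eq_intros)
  have dP: "(Pf has_field_derivative P' * (- (1 / r))) (at w)"
    unfolding Pf_def[abs_def] P'_def
  proof (rule DERIV_chain2[OF g_deriv])
    show "\<bar>Im (of_real (x / s) - w / r)\<bar> < pi / 2" unfolding r_def by (rule sector_strip(2)[OF w])
    show "((\<lambda>w. of_real (x / s) - w / r) has_field_derivative - (1 / r)) (at w)"
      using r(1) by (auto intro!: derivative_eq_intros)
  qed
  have dQ: "(Qf has_field_derivative - (Q * (of_nat (j + 1) * (u / r)))) (at w)"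
    unfolding Qf_def[abs_def] Q_def using r(1) by (auto intro!: derivative_eq_intros)
  have dexp: "((\<lambda>w. (- 1) ^ j * exp (- Ef w)) has_field_derivative (- 1) ^ j * (exp (- E) * (- (E / r)))) (at w)"
    unfolding E_def by (intro DERIV_cmult DERIV_chain2[OF DERIV_exp] DERIV_minus dE[unfolded E_def])
  \<comment> \<open>A pure ring identity over abstract atoms. Its two hypotheses stand for
    \<open>s / (1 + s) = 1 - 1 / (1 + s)\<close> and for \<open>1 / (1 + s)\<close> being
    \<open>s / (1 + s)\<close> divided by \<open>s\<close>.\<close>
  have alg: "((\<sigma> * (e * (- (E * a)))) * P + (P' * (- a)) * (\<sigma> * e)) * Q + (- (Q * (n * q))) * (\<sigma> * e * P)
      = (- 1 * \<sigma>) * e * P * (E * Q) - q * (\<sigma> * e * (- E * P + v + n * P) * Q)"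
    if "q = 1 - a" "P' * a = q * v" for \<sigma> e E a P P' Q n q v :: complex
  proof -
    have 1: "P' * (- a) = - (q * v)" and 2: "a = 1 - q" using that by simp_all
    show ?thesis unfolding 1 unfolding 2 by (simp add: algebra_simps)
  qed
  have "((\<lambda>w. (- 1) ^ j * exp (- Ef w) * Pf w * Qf w) has_field_derivative
     (((- 1) ^ j * (exp (- E) * (- (E * (1 / r))))) * P + (P' * (- (1 / r))) * ((- 1) ^ j * exp (- E))) * Q
      + (- (Q * (of_nat (j + 1) * (u / r)))) * ((- 1) ^ j * exp (- E) * P)) (at w)"
    using DERIV_mult[OF DERIV_mult[OF dexp dP] dQ] by (simp add: E_def P_def Q_def)
  also have "(((- 1) ^ j * (exp (- E) * (- (E * (1 / r))))) * P + (P' * (- (1 / r))) * ((- 1) ^ j * exp (- E))) * Q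
      + (- (Q * (of_nat (j + 1) * (u / r)))) * ((- 1) ^ j * exp (- E) * P)
     = (- 1 * (- 1) ^ j) * exp (- E) * P * (E * Q)
        - u / r * ((- 1) ^ j * exp (- E) * (- E * P + P' / u + of_nat (j + 1) * P) * Q)"
  proof (rule alg)
    show "u / r = 1 - 1 / r" using r(1) by (simp add: r(2) divide_simps)
    show "P' * (1 / r) = u / r * (P' / u)" using r(3) by simp
  qed
  also have "(- 1 * (- 1) ^ j) * exp (- E) * P * (E * Q)
        - u / r * ((- 1) ^ j * exp (- E) * (- E * P + P' / u + of_nat (j + 1) * P) * Q)
      = exp w * kern (Suc j) w x - of_real (s / (1 + s)) * kern_dx j w x"
    unfolding EQ[symmetric] unfolding kern_def kern_dx_def sr power_Suc r_def[symmetric] E_def P_def P'_def Q_def Ef_def Pf_def Qf_def u_def[symmetric]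
    by (simp only: mult_ac)
  also have "(\<lambda>w. (- 1) ^ j * exp (- Ef w) * Pf w * Qf w) = (\<lambda>w. kern j w x)"
    by (simp only: kern_def sr r_def Ef_def Pf_def Qf_def)
  finally show ?thesis by (rule has_field_derivative_at_within)
qed

lemma continuous_kern:
  "continuous_on (sector \<alpha> \<times> UNIV) (\<lambda>(w, x). kern j w x)"
  "continuous_on (sector \<alpha> \<times> UNIV) (\<lambda>(w, x). kern_dx j w x)"
proof -
  have g: "continuous_on {z. \<bar>Im z\<bar> < pi / 2} g" "continuous_on {z. \<bar>Im z\<bar> < pi / 2} (deriv g)"
    using g_hol holomorphic_deriv[OF g_hol open_Im_strip] by (auto intro: holomorphic_on_imp_continuous_on)
  have arg: "continuous_on (sector \<alpha> \<times> UNIV) (\<lambda>p::complex \<times> real. of_real (snd p / s) - fst p / of_real (1 + s))"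
    using s by (intro continuous_intros) (auto simp: complex_eq_iff)
  have sub: "(\<lambda>p::complex \<times> real. of_real (snd p / s) - fst p / of_real (1 + s)) ` (sector \<alpha> \<times> UNIV) \<subseteq> {z. \<bar>Im z\<bar> < pi / 2}"
    using sector_strip(2) by auto
  note c = continuous_on_compose2[OF g(1) arg sub] continuous_on_compose2[OF g(2) arg sub]
  have "complex_of_real (1 + s) \<noteq> 0" using s by (simp add: complex_eq_iff)
  then show "continuous_on (sector \<alpha> \<times> UNIV) (\<lambda>(w, x). kern j w x)"
    "continuous_on (sector \<alpha> \<times> UNIV) (\<lambda>(w, x). kern_dx j w x)"
    unfolding kern_def kern_dx_def case_prod_beta using s by (intro continuous_intros c; simp)+
qed

lemma continuous_kern_x:
  assumes "w \<in> sector \<alpha>"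
  shows "continuous_on T (kern j w)" "continuous_on T (kern_dx j w)"
proof -
  have p: "continuous_on T (\<lambda>x::real. (w, x))" by (intro continuous_intros)
  have sub: "(\<lambda>x::real. (w, x)) ` T \<subseteq> sector \<alpha> \<times> UNIV" using assms by auto
  show "continuous_on T (kern j w)" "continuous_on T (kern_dx j w)"
    using continuous_on_compose2[OF continuous_kern(1)[of j] p sub]
      continuous_on_compose2[OF continuous_kern(2)[of j] p sub] by simp_all
qed

text \<open>On a compact interval differentiation under the integral is allowed, and the exact
  \<open>x\<close>-derivative integrates to boundary terms.\<close>

lemma deriv_truncated:
  assumes w: "w \<in> sector \<alpha>"
  shows "((\<lambda>w. integral {- real n..real n} (kern j w)) has_field_derivative
     exp w * integral {- real n..real n} (kern (Suc j) w)
       - of_real (s / (1 + s)) * (kern j w (real n) - kern j w (- real n))) (at w)"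
proof -
  define D where "D w x = exp w * kern (Suc j) w x - of_real (s / (1 + s)) * kern_dx j w x" for w x
  have "((\<lambda>w. integral (cbox (- real n) (real n)) (kern j w)) has_field_derivative
      integral (cbox (- real n) (real n)) (D w)) (at w within sector \<alpha>)"
  proof (rule leibniz_rule_field_derivative)
    show "((\<lambda>w. kern j w x) has_field_derivative D w x) (at w within sector \<alpha>)" if "w \<in> sector \<alpha>" for w x
      unfolding D_def by (rule has_field_derivative_kern[OF that])
    show "kern j w integrable_on cbox (- real n) (real n)" if "w \<in> sector \<alpha>" for w
      using continuous_kern_x[OF that] by (intro integrable_continuous)
    show "continuous_on (sector \<alpha> \<times> cbox (- real n) (real n)) (\<lambda>(w, x). D w x)"
      unfolding D_def case_prod_beta
      using continuous_kern(1)[of "Suc j"] continuous_kern(2)[of j] unfolding case_prod_beta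
      by (intro continuous_intros) (auto intro: continuous_on_subset)
  qed (use w convex_sector in auto)
  then have *: "((\<lambda>w. integral {- real n..real n} (kern j w)) has_field_derivative
      integral {- real n..real n} (D w)) (at w)"
    using w open_sector by (simp add: at_within_open[of w "sector \<alpha>"])
  have "(kern_dx j w has_integral (kern j w (real n) - kern j w (- real n))) {- real n..real n}"
    by (intro fundamental_theorem_of_calculus has_vector_derivative_at_within[OF has_vector_derivative_kern] w) auto
  moreover have "(kern (Suc j) w has_integral integral {- real n..real n} (kern (Suc j) w)) {- real n..real n}"
    using continuous_kern_x[OF w] by (intro integrable_integral integrable_continuous_real)
  ultimately have "(D w has_integral exp w * integral {- real n..real n} (kern (Suc j) w)
       - of_real (s / (1 + s)) * (kern j w (real n) - kern j w (- real n))) {- real n..real n}"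
    unfolding D_def by (intro has_integral_diff has_integral_mult_right)
  with * show ?thesis by (simp add: integral_unique)
qed

lemma uniform_limit_J:
  assumes "K \<subseteq> sector \<alpha>" "bounded K"
  shows "uniform_limit K (\<lambda>n w. integral {- real n..real n} (kern j w)) (J j) sequentially"
    "\<exists>M. \<forall>w\<in>K. \<forall>x. norm (kern j w x) \<le> M * exp (- \<bar>x\<bar>)"
proof -
  obtain R where R: "\<And>w. w \<in> K \<Longrightarrow> norm w \<le> R" using assms(2) by (auto simp: bounded_iff)
  obtain M where M: "M > 0" "\<And>y. exp (real (j + 1) * y - \<Phi> y) \<le> M * exp (- \<bar>y\<bar>)" using M_ex by blast
  have bound: "norm (kern j w x) \<le> A * M * exp R * exp (- \<bar>x\<bar>)" if w: "w \<in> K" for w x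
  proof -
    define m where "m = s / (1 + s) * Re w"
    have "\<bar>m\<bar> = s / (1 + s) * \<bar>Re w\<bar>" using s by (simp add: m_def abs_mult)
    also have "\<dots> \<le> 1 * \<bar>Re w\<bar>" using s by (intro mult_right_mono) auto
    also have "\<dots> \<le> R" using R[OF w] abs_Re_le_cmod[of w] by linarith
    finally have m: "\<bar>m\<bar> \<le> R" .
    have "norm (kern j w x) \<le> A * exp (real (j + 1) * (x - m) - \<Phi> (x - m))"
      using norm_kern_le[of w j x] w assms(1) by (auto simp: m_def)
    also have "\<dots> \<le> A * (M * exp (- \<bar>x - m\<bar>))" using A M(2)[of "x - m"] by simp
    also have "\<dots> \<le> A * (M * exp (R - \<bar>x\<bar>))" using A M(1) m by simp
    finally show ?thesis by (simp add: exp_diff exp_minus field_simps)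
  qed
  then show "\<exists>M. \<forall>w\<in>K. \<forall>x. norm (kern j w x) \<le> M * exp (- \<bar>x\<bar>)" by blast
  have "\<exists>J'. uniform_limit K (\<lambda>n w. integral {- real n..real n} (kern j w)) J' sequentially"
    using assms(1) by (intro uniform_limit_improper_integral[OF _ bound] continuous_kern_x(1)) auto
  then obtain J' where J': "uniform_limit K (\<lambda>n w. integral {- real n..real n} (kern j w)) J' sequentially"
    by blast
  have eq: "J' w = J j w" if "w \<in> K" for w
    unfolding J_def by (rule limI[OF tendsto_uniform_limitI[OF J' that], symmetric])
  show "uniform_limit K (\<lambda>n w. integral {- real n..real n} (kern j w)) (J j) sequentially"
    using J' by (rule uniform_limit_cong'[THEN iffD1, rotated 2]) (simp_all add: eq)
qed

lemma J_tendsto: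
  assumes "w \<in> sector \<alpha>"
  shows "(\<lambda>n. integral {- real n..real n} (kern j w)) \<longlonglongrightarrow> J j w"
  by (rule tendsto_uniform_limitI[OF uniform_limit_J(1)[of "{w}"]]) (use assms in auto)

text \<open>The truncated integrals converge locally uniformly, so their derivatives converge too;
  the boundary terms decay like \<open>exp (- n)\<close>. The factor \<open>exp w\<close> is the one
  that \<open>z_deriv\<close> divides out.\<close>

lemma J_deriv:
  assumes w: "w \<in> sector \<alpha>"
  shows "(J j has_field_derivative exp w * J (Suc j) w) (at w)"
proof -
  define F' where "F' n w = exp w * integral {- real n..real n} (kern (Suc j) w)
       - of_real (s / (1 + s)) * (kern j w (real n) - kern j w (- real n))" for n w
  have "\<exists>g'. \<forall>w\<in>sector \<alpha>. (J j has_field_derivative g' w) (at w) \<and> (\<lambda>n. F' n w) \<longlonglongrightarrow> g' w"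
  proof (rule has_complex_derivative_uniform_sequence[OF open_sector])
    show "((\<lambda>w. integral {- real n..real n} (kern j w)) has_field_derivative F' n w) (at w)"
      if "w \<in> sector \<alpha>" for n w
      unfolding F'_def by (rule deriv_truncated[OF that])
    fix w assume "w \<in> sector \<alpha>"
    then obtain d where "d > 0" "cball w d \<subseteq> sector \<alpha>" using open_sector open_contains_cball by blast
    then show "\<exists>d>0. cball w d \<subseteq> sector \<alpha> \<and>
        uniform_limit (cball w d) (\<lambda>n w. integral {- real n..real n} (kern j w)) (J j) sequentially"
      using uniform_limit_J(1)[of "cball w d" j] by blast
  qed
  then obtain g' where g': "(J j has_field_derivative g' w) (at w)" "(\<lambda>n. F' n w) \<longlonglongrightarrow> g' w"
    using w by blast
  obtain M where M: "\<And>x. norm (kern j w x) \<le> M * exp (- \<bar>x\<bar>)"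
    using uniform_limit_J(2)[of "{w}" j] w by auto
  have dec: "(\<lambda>n. M * exp (- real n)) \<longlonglongrightarrow> 0" by real_asymp
  have "(\<lambda>n. kern j w (real n)) \<longlonglongrightarrow> 0"
    by (rule Lim_null_comparison[OF _ dec]) (use M[of "real _"] in auto)
  moreover have "(\<lambda>n. kern j w (- real n)) \<longlonglongrightarrow> 0"
    by (rule Lim_null_comparison[OF _ dec]) (use M[of "- real _"] in auto)
  ultimately have "(\<lambda>n. F' n w) \<longlonglongrightarrow> exp w * J (Suc j) w - of_real (s / (1 + s)) * (0 - 0)"
    unfolding F'_def by (intro tendsto_intros J_tendsto w)
  then have "g' w = exp w * J (Suc j) w" using g'(2) LIMSEQ_unique by fastforce
  with g'(1) show ?thesis by simp
qed

lemma J_holomorphic: "J j holomorphic_on sector \<alpha>"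
  unfolding holomorphic_on_open[OF open_sector] using J_deriv by blast

lemma z_deriv_J:
  assumes "w \<in> sector \<alpha>"
  shows "(z_deriv ^^ j) (J 0) w = J j w"
  using assms
proof (induction j arbitrary: w)
  case (Suc j)
  have "\<forall>\<^sub>F v in nhds w. v \<in> sector \<alpha>" using open_sector Suc.prems by (rule eventually_nhds_in_open)
  then have "\<forall>\<^sub>F v in nhds w. (z_deriv ^^ j) (J 0) v = J j v"
    by eventually_elim (rule Suc.IH)
  then have "deriv ((z_deriv ^^ j) (J 0)) w = deriv (J j) w" by (rule deriv_cong_ev) simp
  then show ?case
    using DERIV_imp_deriv[OF J_deriv[OF Suc.prems]] by (simp add: z_deriv_def[of "(z_deriv ^^ j) (J 0)"])
qed simp

text \<open>The majorant of the kernel is centred at a point moving with \<open>Re w\<close>; since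
  \<open>norm_integral_le_pi\<close> does not see the centre, the bound is uniform on the unbounded
  sector.\<close>

lemma norm_J_le:
  assumes w: "w \<in> sector \<alpha>" and M: "M \<ge> 0" "\<And>y. exp (real (j + 1) * y - \<Phi> y) \<le> M * exp (- \<bar>y\<bar>)"
  shows "norm (J j w) \<le> 2 * pi * (A * M)"
proof (rule LIMSEQ_le_const2[OF tendsto_norm[OF J_tendsto[OF w]]], intro exI[of _ 0] allI impI)
  fix n :: nat
  show "norm (integral {- real n..real n} (kern j w)) \<le> 2 * pi * (A * M)"
  proof (rule norm_integral_le_pi[where m = "s / (1 + s) * Re w"])
    fix x
    show "norm (kern j w x) \<le> A * M * exp (- \<bar>x - s / (1 + s) * Re w\<bar>)"
      using order_trans[OF norm_kern_le[OF w, of j x] mult_left_mono[OF M(2)[of "x - s / (1 + s) * Re w"], of A]] A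
      by (simp only: mult.assoc less_imp_le)
  qed (use A M continuous_kern_x[OF w] in auto)
qed

text \<open>At \<open>z = exp (- y)\<close> the contour is the positive axis and the integrand has
  the sign of \<open>(- 1) ^ j\<close>, so a piece of the integral bounds it from below. For
  \<open>ln t\<close> in \<open>{y - 1..y}\<close> one has \<open>z * t \<le> 1\<close>, which gives
  \<open>exp (- 1)\<close>, and monotonicity of \<open>G\<close> gives
  \<open>G (y / s)\<close>.\<close>

lemma J_real_lower:
  assumes real: "\<And>x. g (of_real x) = of_real (G x)" "\<And>x. G x \<ge> 0" "\<And>x y. x \<le> y \<Longrightarrow> G y \<le> G x"
  shows "\<exists>R\<ge>0. J j (of_real (- y)) = (- 1) ^ j * of_real R \<and>
     R \<ge> exp (- 1) * G (y / s) * exp (real (j + 1) * (y - 1))"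
proof -
  define m where "m = s / (1 + s) * (- y)"
  define r where "r x = exp (- exp (- y + (x - m))) * G ((x - m) / s) * exp (real (j + 1) * (x - m))" for x
  define w0 where "w0 = complex_of_real (- y)"
  have w: "w0 \<in> sector \<alpha>" using \<alpha> by (simp add: sector_def w0_def)
  have sq: "(- 1) ^ j * ((- 1) ^ j * z) = z" for z :: complex
    by (simp add: mult.assoc[symmetric] power_mult_distrib[symmetric])
  have r_nonneg: "r x \<ge> 0" for x by (simp add: r_def real)
  have kern_r: "kern j w0 x = (- 1) ^ j * of_real (r x)" for x
  proof -
    have 1: "x + (- y) / (1 + s) = - y + (x - m)" "x / s - (- y) / (1 + s) = (x - m) / s"
      using s by (auto simp: m_def field_simps)
    have "kern j w0 x = (- 1) ^ j * of_real (exp (- exp (x + (- y) / (1 + s)))) *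
       g (of_real (x / s - (- y) / (1 + s))) * of_real (exp (real (j + 1) * (x - s / (1 + s) * (- y))))"
      unfolding kern_def w0_def by (simp flip: exp_of_real)
    then show ?thesis unfolding 1 real r_def m_def[symmetric] by simp
  qed
  define I where "I n = integral {- real n..real n} r" for n :: nat
  have r_cont: "continuous_on T r" for T
  proof -
    have "continuous_on T (\<lambda>x. Re ((- 1) ^ j * kern j w0 x))"
      by (intro continuous_intros continuous_kern_x w)
    then show ?thesis unfolding kern_r sq by simp
  qed
  have r_int: "r integrable_on {a..b}" for a b by (intro integrable_continuous_real r_cont)
  have int_kern: "integral {- real n..real n} (kern j w0) = (- 1) ^ j * of_real (I n)" for n
  proof -
    have "(r has_integral I n) {- real n..real n}" unfolding I_def by (intro integrable_integral r_int)
    then have "((\<lambda>x. (- 1) ^ j * complex_of_real (r x)) has_integral (- 1) ^ j * of_real (I n)) {- real n..real n}"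
      by (intro has_integral_mult_right has_integral_of_real)
    moreover have "kern j w0 = (\<lambda>x. (- 1) ^ j * complex_of_real (r x))" by (rule ext) (rule kern_r)
    ultimately show ?thesis by (simp only: integral_unique)
  qed
  define R where "R = Re ((- 1) ^ j * J j w0)"
  have "(\<lambda>n. (- 1) ^ j * integral {- real n..real n} (kern j w0)) \<longlonglongrightarrow> (- 1) ^ j * J j w0"
    by (intro tendsto_intros J_tendsto w)
  then have lim: "(\<lambda>n. complex_of_real (I n)) \<longlonglongrightarrow> (- 1) ^ j * J j w0"
    unfolding int_kern sq .
  have limR: "I \<longlonglongrightarrow> R" using tendsto_Re[OF lim] by (simp add: R_def)
  have "(- 1) ^ j * J j w0 = of_real R"
    using LIMSEQ_unique[OF lim tendsto_of_real[OF limR]] .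
  then have "(- 1) ^ j * ((- 1) ^ j * J j w0) = (- 1) ^ j * of_real R" by simp
  then have J_eq: "J j w0 = (- 1) ^ j * of_real R"
    unfolding sq .
  have I_nonneg: "I n \<ge> 0" for n unfolding I_def by (intro integral_nonneg r_int r_nonneg)
  have R0: "R \<ge> 0" by (rule LIMSEQ_le_const[OF limR]) (use I_nonneg in auto)
  define L where "L = exp (- 1) * G (y / s) * exp (real (j + 1) * (y - 1))"
  have L_le: "L \<le> r x" if "x \<in> {y - 1 + m..y + m}" for x
    unfolding L_def r_def using that s real
    by (intro mult_mono real(3)) (auto intro!: divide_right_mono mult_nonneg_nonneg)
  have "L \<le> R"
  proof (rule LIMSEQ_le_const[OF limR], intro exI[of _ "nat \<lceil>\<bar>y\<bar> + \<bar>m\<bar> + 1\<rceil>"] allI impI)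
    fix n assume "nat \<lceil>\<bar>y\<bar> + \<bar>m\<bar> + 1\<rceil> \<le> n"
    then have n: "\<bar>y\<bar> + \<bar>m\<bar> + 1 \<le> real n" by linarith
    have "L = integral {y - 1 + m..y + m} (\<lambda>_. L)" by simp
    also have "\<dots> \<le> integral {y - 1 + m..y + m} r" by (intro integral_le r_int L_le) auto
    also have "\<dots> \<le> I n" unfolding I_def
      using n by (intro integral_subset_le r_int) (auto simp: r_nonneg)
    finally show "L \<le> I n" .
  qed
  then show ?thesis using R0 J_eq by (auto simp: L_def w0_def)
qed

end

section \<open>Construction of the decaying kernel and of the characteristic functions\<close>

context weight_W0
begin

text \<open>Since \<open>\<omega>(t\<^sup>s)\<close> is almost concave, \<open>exp (- \<epsilon> \<omega>(t\<^sup>s))\<close> is comparable to the superposition of the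
  exponentials \<open>exp (- a\<^sub>n - b\<^sub>n t)\<close>, where \<open>a\<^sub>n + b\<^sub>n t\<close> is essentially the tangent of
  \<open>\<epsilon> \<omega>(t\<^sup>s)\<close> at \<open>t = exp (x\<^sub>0 + n)\<close>. The superposition is holomorphic in the right half plane; below
  it is written in the variable \<open>ln t\<close>.\<close>

lemma decay_kernel:
  assumes alpha0: "alpha0 (power_weight \<omega> s)" and s: "s > 0" and l: "l > 0"
    and \<theta>: "0 \<le> \<theta>" "\<theta> < pi / 2"
  obtains g :: "complex \<Rightarrow> complex" and G :: "real \<Rightarrow> real" and \<epsilon> A c y1
  where "\<epsilon> > 0" "A > 0" "c > 0" "y1 \<ge> 0"
    "g holomorphic_on {z. \<bar>Im z\<bar> < pi / 2}"
    "\<And>z. \<bar>Im z\<bar> \<le> \<theta> \<Longrightarrow> norm (g z) \<le> A * exp (- \<epsilon> * phi (s * Re z))"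
    "\<And>x. g (of_real x) = of_real (G x)" "\<And>x. G x \<ge> 0" "\<And>x y. x \<le> y \<Longrightarrow> G y \<le> G x"
    "\<And>y. y \<ge> y1 \<Longrightarrow> G (y / s) \<ge> c * exp (- phi y / l)"
proof -
  obtain C x0 where C: "C \<ge> 1" and x0: "x0 \<ge> 0" and
    C_ineq: "\<And>a x. a \<ge> 0 \<Longrightarrow> x \<ge> x0 \<Longrightarrow> phi (s * (x + a)) \<le> C * exp a * phi (s * x)"
    using alpha0_power_weightE[OF alpha0] by metis
  define kap where "kap x = phi (s * x)" for x
  have kap_mono: "kap x \<le> kap y" if "x \<le> y" for x y
    unfolding kap_def using that s by (intro phi_mono) auto
  have kap_nonneg [simp]: "kap x \<ge> 0" for x by (simp add: kap_def)
  have kap_ineq: "kap (x + a) \<le> C * exp a * kap x" if "a \<ge> 0" "x \<ge> x0" for a x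
    using C_ineq[OF that] by (simp add: kap_def)
  define C2 where "C2 = (1 + C) * (C * exp 1)"
  \<comment> \<open>With this choice \<open>\<epsilon>0 * C2 = 1 / (2 * l)\<close>: half of the
    admissible exponent \<open>phi y / l\<close> pays for the lines, the other half for the small
    weights \<open>p n\<close>.\<close>
  define \<epsilon>0 where "\<epsilon>0 = 1 / (2 * l * C2)"
  have C2: "C2 > 0" using C by (simp add: C2_def)
  have \<epsilon>0: "\<epsilon>0 > 0" using C2 l by (simp add: \<epsilon>0_def)
  define a where "a n = \<epsilon>0 * kap (x0 + real n)" for n
  define b where "b n = \<epsilon>0 * (C * exp (- (x0 + real n)) * kap (x0 + real n))" for n
  have a_nonneg: "a n \<ge> 0" for n using \<epsilon>0 by (simp add: a_def)
  have b_nonneg: "b n \<ge> 0" for n using \<epsilon>0 C by (simp add: b_def)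
  define p :: "nat \<Rightarrow> real" where "p n = (1/2) ^ Suc n" for n
  have p_sums: "p sums 1" unfolding p_def by (rule power_half_series)
  have p_pos: "p n > 0" for n by (simp add: p_def)
  have p_summable: "summable p" using p_sums by (rule sums_summable)
  define g where "g z = (\<Sum>n. of_real (p n) * exp (- of_real (a n) - of_real (b n) * exp z))" for z :: complex
  define G where "G x = (\<Sum>n. p n * exp (- a n - b n * exp x))" for x :: real
  have norm_term: "norm (of_real (p n) * exp (- of_real (a n) - of_real (b n) * exp z))
      = p n * exp (- a n - b n * Re (exp z))" for n and z :: complex
    using p_pos[of n] by (simp add: norm_mult)
  have G_term_le: "p n * exp (- a n - b n * x) \<le> p n" if "x \<ge> 0" for n and x :: real
  proof -
    have "a n + b n * x \<ge> 0" using a_nonneg b_nonneg that by simp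
    then have "exp (- a n - b n * x) \<le> 1" by simp
    then show ?thesis using p_pos[of n] by simp
  qed
  have G_summable: "summable (\<lambda>n. p n * exp (- a n - b n * exp x))" for x
    using G_term_le[of "exp x"] p_pos
    by (intro summable_comparison_test'[OF p_summable, of 0]) (auto simp: less_imp_le)
  \<comment> \<open>Left of the node \<open>x0 + n\<close> the constant \<open>a n\<close> suffices
    by monotonicity; right of it \<open>alpha0\<close> puts the linear term
    \<open>b n * exp X\<close> above the weight.\<close>
  have lower_line: "\<epsilon>0 * kap X \<le> a n + b n * exp X" for X n
  proof (cases "X \<le> x0 + real n")
    case True
    have "\<epsilon>0 * kap X \<le> a n" using kap_mono[OF True] \<epsilon>0 by (simp add: a_def)
    moreover have "0 \<le> b n * exp X" using b_nonneg by simp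
    ultimately show ?thesis by linarith
  next
    case False
    then have "kap ((x0 + real n) + (X - (x0 + real n))) \<le> C * exp (X - (x0 + real n)) * kap (x0 + real n)"
      by (intro kap_ineq) auto
    then have "kap X \<le> C * exp (- (x0 + real n)) * kap (x0 + real n) * exp X"
      by (simp add: exp_diff exp_minus exp_add field_simps)
    then have "\<epsilon>0 * kap X \<le> \<epsilon>0 * (C * exp (- (x0 + real n)) * kap (x0 + real n) * exp X)"
      using \<epsilon>0 by (intro mult_left_mono) auto
    then have "\<epsilon>0 * kap X \<le> b n * exp X" by (simp add: b_def mult_ac)
    then show ?thesis using a_nonneg[of n] by linarith
  qed
  \<comment> \<open>On the strip of half-width \<open>\<theta>\<close> the real part of
    \<open>exp z\<close> shrinks by at most \<open>cos \<theta>\<close>, a shift of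
    \<open>Re z\<close> by \<open>d\<close>. The constant \<open>K\<close> undoes this shift at the
    price of a smaller \<open>\<epsilon>\<close>.\<close>
  define d where "d = - ln (cos \<theta>)"
  have cos\<theta>: "0 < cos \<theta>" "cos \<theta> \<le> 1" using \<theta> by (auto intro!: cos_gt_zero_pi)
  have d: "d \<ge> 0" "exp (- d) = cos \<theta>" using cos\<theta> by (auto simp: d_def)
  define K where "K = C * exp d"
  have K: "K \<ge> 1" using C d(1) unfolding K_def by (intro mult_ge1_I) auto
  have kap_shift: "kap X \<le> K * kap (X - d) + kap (x0 + d)" for X
  proof (cases "X - d \<ge> x0")
    case True
    have "kap ((X - d) + d) \<le> C * exp d * kap (X - d)" using True d by (intro kap_ineq) auto
    then have "kap X \<le> K * kap (X - d)" by (simp add: K_def)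
    then show ?thesis using kap_nonneg[of "x0 + d"] by linarith
  next
    case False
    then have "kap X \<le> kap (x0 + d)" by (intro kap_mono) auto
    moreover have "K * kap (X - d) \<ge> 0" using K by simp
    ultimately show ?thesis by linarith
  qed
  define \<epsilon> where "\<epsilon> = \<epsilon>0 / K"
  have \<epsilon>: "\<epsilon> > 0" using \<epsilon>0 K by (simp add: \<epsilon>_def)
  define A where "A = exp (\<epsilon> * kap (x0 + d))"
  have upper: "norm (g z) \<le> A * exp (- \<epsilon> * phi (s * Re z))" if z: "\<bar>Im z\<bar> \<le> \<theta>" for z
  proof -
    define X where "X = Re z - d"
    have "cos \<theta> \<le> cos \<bar>Im z\<bar>" using z \<theta> by (intro cos_monotone_0_pi_le) auto
    then have "exp (Re z) * exp (- d) \<le> exp (Re z) * cos (Im z)" unfolding d(2) by simp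
    then have "exp X \<le> Re (exp z)" by (simp add: X_def Re_exp exp_add[symmetric])
    then have "norm (of_real (p n) * exp (- of_real (a n) - of_real (b n) * exp z)) \<le> p n * exp (- \<epsilon>0 * kap X)" for n
      unfolding norm_term
      using lower_line[of X n] mult_left_mono[OF _ b_nonneg[of n], of "exp X" "Re (exp z)"] p_pos[of n]
      by simp
    then have "norm (g z) \<le> (\<Sum>n. p n * exp (- \<epsilon>0 * kap X))"
      unfolding g_def by (intro norm_suminf_le summable_mult2 p_summable)
    also have "\<dots> = exp (- \<epsilon>0 * kap X)"
      using sums_unique[OF p_sums] suminf_mult2[OF p_summable, of "exp (- \<epsilon>0 * kap X)"] by simp
    also have "- \<epsilon>0 * kap X \<le> \<epsilon> * kap (x0 + d) - \<epsilon> * kap (Re z)"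
    proof -
      have "\<epsilon> * kap (Re z) \<le> \<epsilon> * (K * kap X + kap (x0 + d))"
        unfolding X_def using kap_shift \<epsilon> by (intro mult_left_mono) auto
      also have "\<dots> = \<epsilon>0 * kap X + \<epsilon> * kap (x0 + d)" using K by (simp add: \<epsilon>_def ring_distribs)
      finally show ?thesis by simp
    qed
    finally show ?thesis by (simp add: A_def kap_def exp_diff exp_minus field_simps)
  qed
  have hol: "g holomorphic_on {z. \<bar>Im z\<bar> < pi / 2}"
  proof (rule uniform_limit_imp_holomorphic)
    show "open {z. \<bar>Im z\<bar> < pi / 2}" by (rule open_Im_strip)
    show "uniform_limit {z. \<bar>Im z\<bar> < pi / 2}
        (\<lambda>N z. \<Sum>n<N. of_real (p n) * exp (- of_real (a n) - of_real (b n) * exp z)) g sequentially"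
      unfolding g_def
    proof (rule Weierstrass_m_test[OF _ p_summable])
      fix n z assume "z \<in> {z. \<bar>Im z\<bar> < pi / 2}"
      then have "cos (Im z) > 0" by (intro cos_gt_zero_pi) auto
      then have "Re (exp z) \<ge> 0" unfolding Re_exp by (intro mult_nonneg_nonneg) auto
      then show "norm (of_real (p n) * exp (- of_real (a n) - of_real (b n) * exp z)) \<le> p n"
        unfolding norm_term by (rule G_term_le)
    qed
  qed (intro holomorphic_intros)
  have real: "g (of_real x) = of_real (G x)" for x
    unfolding G_def suminf_of_real[OF G_summable] g_def by (simp flip: exp_of_real)
  have G_nonneg: "G x \<ge> 0" for x
    unfolding G_def using p_pos by (intro suminf_nonneg G_summable) (auto simp: less_imp_le)
  have G_anti: "G y \<le> G x" if "x \<le> y" for x y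
    unfolding G_def
  proof (intro suminf_le G_summable)
    fix n
    have "b n * exp x \<le> b n * exp y" using that b_nonneg by (intro mult_left_mono) auto
    then show "p n * exp (- a n - b n * exp y) \<le> p n * exp (- a n - b n * exp x)"
      using p_pos[of n] by simp
  qed
  have G_lower: "G X \<ge> exp (- X - 2 - \<epsilon>0 * C2 * kap X)" if X: "X \<ge> x0" for X
  proof -
    \<comment> \<open>The first node not left of \<open>X\<close>: a single summand already gives
      the lower bound, and its node exceeds \<open>X\<close> by at most 1.\<close>
    define n where "n = nat \<lceil>X - x0\<rceil>"
    have n: "X \<le> x0 + real n" "x0 + real n \<le> X + 1"
    proof -
      have "real n = of_int \<lceil>X - x0\<rceil>" using X by (simp add: n_def)
      then show "X \<le> x0 + real n" "x0 + real n \<le> X + 1"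
        using ceiling_correct[of "X - x0"] by linarith+
    qed
    have "kap (x0 + real n) \<le> kap (X + 1)" using n by (intro kap_mono)
    also have "\<dots> \<le> C * exp 1 * kap X" using X by (intro kap_ineq) auto
    finally have kapn: "kap (x0 + real n) \<le> C * exp 1 * kap X" .
    have "exp (- (x0 + real n)) * exp X \<le> 1" using n by (simp add: exp_add[symmetric])
    then have "b n * exp X \<le> \<epsilon>0 * (C * kap (x0 + real n))"
      using \<epsilon>0 C mult_right_mono[of "exp (- (x0 + real n)) * exp X" 1 "\<epsilon>0 * (C * kap (x0 + real n))"]
      by (simp add: b_def mult_ac)
    then have "a n + b n * exp X \<le> \<epsilon>0 * ((1 + C) * kap (x0 + real n))"
      by (simp add: a_def algebra_simps)
    also have "\<dots> \<le> \<epsilon>0 * ((1 + C) * (C * exp 1 * kap X))"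
      using \<epsilon>0 C kapn by (intro mult_left_mono) auto
    finally have ab: "a n + b n * exp X \<le> \<epsilon>0 * C2 * kap X" by (simp add: C2_def)
    have "exp (- X - 2) \<le> exp (- 1) ^ Suc n"
      using n x0 by (simp add: exp_of_nat_mult[symmetric] del: power_Suc)
    also have "\<dots> \<le> p n"
      unfolding p_def using exp_ge_add_one_self[of 1] by (intro power_mono) (auto simp: exp_minus field_simps)
    finally have "exp (- X - 2) * exp (- \<epsilon>0 * C2 * kap X) \<le> p n * exp (- a n - b n * exp X)"
      using ab by (intro mult_mono) (auto simp: p_def)
    also have "\<dots> \<le> G X"
      unfolding G_def using sum_le_suminf[OF G_summable[of X], of "{n}"] p_pos by (auto simp: less_imp_le)
    finally show ?thesis by (simp add: exp_add[symmetric] algebra_simps)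
  qed
  obtain B where B: "\<And>y. 2 * l / s * y \<le> phi y + B" using phi_superlinear[of "2 * l / s"] s l by auto
  have low: "G (y / s) \<ge> exp (- 2 - B / (2 * l)) * exp (- phi y / l)" if y: "y \<ge> s * x0" for y
  proof -
    have "y / s = (2 * l / s * y) / (2 * l)" using l by simp
    also have "\<dots> \<le> (phi y + B) / (2 * l)" using B l by (intro divide_right_mono) auto
    finally have 1: "y / s \<le> phi y / (2 * l) + B / (2 * l)" by (simp add: add_divide_distrib)
    have 2: "\<epsilon>0 * C2 * kap (y / s) = phi y / (2 * l)"
      using C2 s by (simp add: \<epsilon>0_def kap_def)
    have 3: "phi y / l = phi y / (2 * l) + phi y / (2 * l)" using l by (simp add: field_simps)
    have "exp (- 2 - B / (2 * l)) * exp (- phi y / l) \<le> exp (- (y / s) - 2 - \<epsilon>0 * C2 * kap (y / s))"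
      unfolding exp_add[symmetric] exp_le_cancel_iff using 1 2 3 by linarith
    also have "\<dots> \<le> G (y / s)" using y s by (intro G_lower) (auto simp: field_simps)
    finally show ?thesis .
  qed
  show ?thesis
    by (rule that[of \<epsilon> A "exp (- 2 - B / (2 * l))" "s * x0" g G])
       (use \<epsilon> hol upper real G_nonneg G_anti low s x0 in \<open>auto simp: A_def\<close>)
qed

end

context weight_W0
begin

text \<open>For \<open>y \<ge> 0\<close> one further power of \<open>exp y\<close> is spent on the
  decay, hence the index \<open>j + 2\<close>. For \<open>y < 0\<close> the exponent
  \<open>j + 1\<close>, at least 1, already provides it.\<close>

lemma exp_weight_decay:
  assumes "\<epsilon> > 0"
  shows "exp (real (j + 1) * y - \<epsilon> * phi y) \<le> W (1 / \<epsilon>) (j + 2) * exp (- \<bar>y\<bar>)"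
proof (cases "y \<ge> 0")
  case True
  have "exp (real (j + 1) * y - \<epsilon> * phi y) = exp (real (j + 2) * y - phi y / (1 / \<epsilon>)) * exp (- \<bar>y\<bar>)"
    using True by (simp add: exp_add[symmetric] algebra_simps)
  also have "\<dots> \<le> W (1 / \<epsilon>) (j + 2) * exp (- \<bar>y\<bar>)"
    using assms by (intro mult_right_mono W_ge) auto
  finally show ?thesis .
next
  case False
  have "real (j + 1) * y - \<epsilon> * phi y \<le> - \<bar>y\<bar>"
  proof -
    have "real j * y \<le> 0" using False by (simp add: mult_nonneg_nonpos)
    moreover have "\<epsilon> * phi y \<ge> 0" using assms by simp
    ultimately show ?thesis using False by (simp add: algebra_simps)
  qed
  then have "exp (real (j + 1) * y - \<epsilon> * phi y) \<le> 1 * exp (- \<bar>y\<bar>)" by simp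
  also have "\<dots> \<le> W (1 / \<epsilon>) (j + 2) * exp (- \<bar>y\<bar>)"
    using assms by (intro mult_right_mono W_ge_1) auto
  finally show ?thesis .
qed

lemma characteristic_function:
  assumes alpha0: "alpha0 (power_weight \<omega> s)" and s: "s > \<alpha> - 1" "s > 0" and \<alpha>: "\<alpha> > 0" and l: "l > 0"
  obtains c f where "c > 0" "f \<in> ultrahol_class \<omega> (sector \<alpha>)"
    "\<And>y. y \<ge> 0 \<Longrightarrow> \<exists>x::real. \<exists>R. \<forall>j. R j \<ge> 0 \<and> (z_deriv ^^ j) f (of_real x) = (- 1) ^ j * of_real (R j) \<and>
        R j \<ge> c * exp (- real j) * exp (real j * y - phi y / l)"
proof -
  define \<theta> where "\<theta> = \<alpha> / (1 + s) * pi / 2"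
  have "\<alpha> / (1 + s) < 1" using s \<alpha> by simp
  moreover have "q * pi / 2 < pi / 2" if "q < 1" for q using that by simp
  ultimately have "\<theta> < pi / 2" unfolding \<theta>_def by blast
  then have \<theta>: "0 \<le> \<theta>" "\<theta> < pi / 2" using s \<alpha> by (auto simp: \<theta>_def)
  obtain g G \<epsilon> A c y1 where \<epsilon>: "\<epsilon> > 0" and A: "A > 0" and c: "c > 0" and y1: "y1 \<ge> 0" and
    g: "g holomorphic_on {z. \<bar>Im z\<bar> < pi / 2}"
    "\<And>z. \<bar>Im z\<bar> \<le> \<theta> \<Longrightarrow> norm (g z) \<le> A * exp (- \<epsilon> * phi (s * Re z))"
    and G: "\<And>x. g (of_real x) = of_real (G x)" "\<And>x. G x \<ge> 0" "\<And>x y. x \<le> y \<Longrightarrow> G y \<le> G x"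
    and low: "\<And>y. y \<ge> y1 \<Longrightarrow> G (y / s) \<ge> c * exp (- phi y / l)"
    by (rule decay_kernel[OF alpha0 s(2) l \<theta>]) (rule that; (assumption | meson))
  interpret contour_kernel g s \<alpha> A "\<lambda>y. \<epsilon> * phi y"
  proof
    show "\<exists>M>0. \<forall>y. exp (real (j + 1) * y - \<epsilon> * phi y) \<le> M * exp (- \<bar>y\<bar>)" for j
      using exp_weight_decay[OF \<epsilon>] W_pos by blast
  qed (use s \<alpha> g A in \<open>auto simp: \<theta>_def\<close>)
  \<comment> \<open>Doubling the row lets \<open>W_add\<close> split the index \<open>j + 2\<close>
    into \<open>j\<close> and the constant contribution of 2.\<close>
  define l' where "l' = 2 * (1 / \<epsilon>)"
  have l': "l' > 0" using \<epsilon> by (simp add: l'_def)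
  have "norm ((z_deriv ^^ j) (J 0) w) \<le> (2 * pi * A * W l' 2) * W l' j" if w: "w \<in> sector \<alpha>" for w j
  proof -
    have "norm (J j w) \<le> 2 * pi * (A * W (1 / \<epsilon>) (j + 2))"
      using exp_weight_decay[OF \<epsilon>] by (intro norm_J_le[OF w]) (auto intro: less_imp_le)
    also have "\<dots> \<le> 2 * pi * (A * (W l' j * W l' 2))"
      unfolding l'_def using A \<epsilon> by (intro mult_left_mono W_add) auto
    finally show ?thesis unfolding z_deriv_J[OF w] by (simp only: mult_ac)
  qed
  then have J_class: "J 0 \<in> ultrahol_class \<omega> (sector \<alpha>)"
    using J_holomorphic l' A by (intro ultrahol_classI[of _ _ l' "2 * pi * A * W l' 2"]) auto
  have main: "\<exists>R. \<forall>j. R j \<ge> 0 \<and> (z_deriv ^^ j) (J 0) (of_real (- y)) = (- 1) ^ j * of_real (R j) \<and>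
        R j \<ge> exp (- 2) * c * exp (- real j) * exp (real j * y - phi y / l)" if y: "y \<ge> y1" for y
  proof -
    have "\<exists>R\<ge>0. J j (of_real (- y)) = (- 1) ^ j * of_real R \<and>
        R \<ge> exp (- 2) * c * exp (- real j) * exp (real j * y - phi y / l)" for j
    proof -
      obtain R where R: "R \<ge> 0" "J j (of_real (- y)) = (- 1) ^ j * of_real R"
        "R \<ge> exp (- 1) * G (y / s) * exp (real (j + 1) * (y - 1))"
        using J_real_lower[OF G] by blast
      have "exp (- 2) * c * exp (- real j) * exp (real j * y - phi y / l)
          = exp (- 1) * (c * exp (- phi y / l)) * exp (real (j + 1) * (- 1) + real j * y)"
        by (simp add: exp_diff exp_add exp_minus field_simps) (simp flip: exp_add)
      also have "\<dots> \<le> exp (- 1) * G (y / s) * exp (real (j + 1) * (y - 1))"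
        using low[OF y] y y1 G c by (intro mult_mono) (auto simp: algebra_simps)
      finally show ?thesis using R by (intro exI[of _ R]) auto
    qed
    moreover have "complex_of_real (- y) \<in> sector \<alpha>" using \<alpha> by (simp add: sector_def)
    ultimately show ?thesis using z_deriv_J by metis
  qed
  show ?thesis
  proof (rule that[of "exp (- 2) * c * exp (- phi y1 / l)" "J 0"])
    fix y :: real assume y: "y \<ge> 0"
    \<comment> \<open>The lower bound for \<open>G\<close> starts at \<open>y1\<close>. Smaller
      \<open>y\<close> are moved up to \<open>y1\<close>, which costs the constant
      \<open>exp (- phi y1 / l)\<close>.\<close>
    define y' where "y' = max y y1"
    obtain R where R: "\<And>j. R j \<ge> 0" "\<And>j. (z_deriv ^^ j) (J 0) (of_real (- y')) = (- 1) ^ j * of_real (R j)"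
        "\<And>j. R j \<ge> exp (- 2) * c * exp (- real j) * exp (real j * y' - phi y' / l)"
      using main[of y'] by (auto simp: y'_def)
    have "R j \<ge> exp (- 2) * c * exp (- phi y1 / l) * exp (- real j) * exp (real j * y - phi y / l)" for j
    proof -
      have "phi y' \<le> phi y1 + phi y" by (auto simp: y'_def max_def)
      then have "phi y' / l \<le> phi y1 / l + phi y / l"
        using divide_right_mono[of "phi y'" "phi y1 + phi y" l] l by (simp add: add_divide_distrib)
      moreover have "real j * y \<le> real j * y'" by (intro mult_left_mono) (auto simp: y'_def)
      ultimately have "exp (- phi y1 / l) * exp (real j * y - phi y / l) \<le> exp (real j * y' - phi y' / l)"
        unfolding exp_add[symmetric] by simp
      then have "(exp (- 2) * c * exp (- real j)) * (exp (- phi y1 / l) * exp (real j * y - phi y / l))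
          \<le> (exp (- 2) * c * exp (- real j)) * exp (real j * y' - phi y' / l)"
        using c by (intro mult_left_mono) auto
      then show ?thesis using R(3)[of j] by (simp add: mult_ac)
    qed
    with R show "\<exists>x::real. \<exists>R. \<forall>j. R j \<ge> 0 \<and> (z_deriv ^^ j) (J 0) (of_real x) = (- 1) ^ j * of_real (R j) \<and>
        R j \<ge> exp (- 2) * c * exp (- phi y1 / l) * exp (- real j) * exp (real j * y - phi y / l)"
      by blast
  qed (use c J_class in auto)
qed

end

section \<open>From inverse-closedness to almost monotonicity\<close>

text \<open>All terms of the recursion are nonnegative, so keeping only \<open>i = j\<close> gives a
  factor \<open>a j / u\<close> each time the index grows by \<open>j\<close>; after
  \<open>n\<close> rounds this is the claimed power.\<close>

lemma reciprocal_coeffs_ge: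
  fixes \<eta> :: "nat \<Rightarrow> complex" and a :: "nat \<Rightarrow> real"
  assumes u: "u > 0" and a: "\<And>i. a i \<ge> 0" and \<eta>0: "\<eta> 0 = of_real (1 / u)"
    and rec: "\<And>k. k \<ge> 1 \<Longrightarrow> of_real u * \<eta> k = (\<Sum>i = 1..k. of_real (a i) * \<eta> (k - i))"
    and j: "j \<ge> 1"
  shows "a j ^ n / u ^ Suc n \<le> norm (\<eta> (j * n))"
proof -
  have "\<exists>r\<ge>0. \<eta> k = of_real r" for k
  proof (induction k rule: less_induct)
    case (less k)
    show ?case
    proof (cases "k = 0")
      case True
      then show ?thesis using \<eta>0 u by (intro exI[of _ "1 / u"]) auto
    next
      case False
      have "\<forall>i\<in>{1..k}. \<exists>r\<ge>0. \<eta> (k - i) = of_real r" using False by (auto intro!: less)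
      then obtain r where r: "\<And>i. i \<in> {1..k} \<Longrightarrow> r i \<ge> 0 \<and> \<eta> (k - i) = of_real (r i)" by metis
      have "of_real u * \<eta> k = of_real (\<Sum>i = 1..k. a i * r i)"
        using rec[of k] False r by simp
      then have "\<eta> k = of_real ((\<Sum>i = 1..k. a i * r i) / u)"
        using u by (simp add: field_simps)
      moreover have "(\<Sum>i = 1..k. a i * r i) / u \<ge> 0"
        using u r a by (intro divide_nonneg_pos sum_nonneg mult_nonneg_nonneg) auto
      ultimately show ?thesis by blast
    qed
  qed
  then obtain h where h: "\<And>k. h k \<ge> 0" "\<And>k. \<eta> k = of_real (h k)" by metis
  have h_rec: "u * h k = (\<Sum>i = 1..k. a i * h (k - i))" if "k \<ge> 1" for k
  proof -
    have "complex_of_real (u * h k) = of_real (\<Sum>i = 1..k. a i * h (k - i))"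
      using rec[OF that] by (simp add: h)
    then show ?thesis by (simp only: of_real_eq_iff)
  qed
  have "a j ^ n / u ^ Suc n \<le> h (j * n)"
  proof (induction n)
    case 0
    have "h 0 = 1 / u" using \<eta>0 h(2)[of 0] by (simp only: of_real_eq_iff)
    then show ?case by simp
  next
    case (Suc n)
    have "a j * h (j * Suc n - j) \<le> (\<Sum>i = 1..j * Suc n. a i * h (j * Suc n - i))"
      using j by (intro member_le_sum) (auto intro: mult_nonneg_nonneg a h)
    also have "\<dots> = u * h (j * Suc n)" using j by (intro h_rec[symmetric]) auto
    finally have "a j * h (j * n) \<le> u * h (j * Suc n)" by simp
    moreover have "a j * (a j ^ n / u ^ Suc n) \<le> a j * h (j * n)" by (intro mult_left_mono Suc a)
    ultimately have "a j * (a j ^ n / u ^ Suc n) \<le> h (j * Suc n) * u" by (simp only: mult.commute)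
    then have "a j * (a j ^ n / u ^ Suc n) / u \<le> h (j * Suc n)" using u by (subst pos_divide_le_eq) auto
    then show ?case using u by (simp add: mult_ac)
  qed
  then show ?thesis using h by simp
qed

context weight_W0
begin

text \<open>With the signs of the derivatives of \<open>f\<close>, all terms in the recursion for the Taylor
  coefficients of \<open>1 / (b - f)\<close> have the same sign, so that no cancellation occurs.\<close>

lemma inverse_closed_imp_rai_log:
  assumes alpha0: "alpha0 (power_weight \<omega> s)" and s: "s > \<alpha> - 1" "s > 0" and \<alpha>: "\<alpha> > 0"
    and inv: "inverse_closed \<omega> (sector \<alpha>)"
  shows rai_log
proof (rule rai_log_if_power_bound)
  fix l :: real assume l: "l > 0"
  obtain c f where c: "c > 0" and f: "f \<in> ultrahol_class \<omega> (sector \<alpha>)" and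
    char: "\<And>y. y \<ge> 0 \<Longrightarrow> \<exists>x::real. \<exists>R. \<forall>j. R j \<ge> 0 \<and> (z_deriv ^^ j) f (of_real x) = (- 1) ^ j * of_real (R j) \<and>
        R j \<ge> c * exp (- real j) * exp (real j * y - phi y / l)"
    by (rule characteristic_function[OF alpha0 s \<alpha> l]) (rule that; blast)
  obtain lf Cf where lf: "lf > 0" and Cf: "Cf > 0" and f_hol: "f holomorphic_on sector \<alpha>"
    and f_bound: "\<And>w j. w \<in> sector \<alpha> \<Longrightarrow> cmod ((z_deriv ^^ j) f w) \<le> Cf * W lf j"
    using f unfolding ultrahol_class_iff by blast
  have f_le: "cmod (f w) \<le> Cf" if "w \<in> sector \<alpha>" for w using f_bound[OF that, of 0] lf by simp
  \<comment> \<open>This keeps \<open>b - f\<close> at distance at least 1 from 0, and its real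
    value \<open>u\<close> at the chosen points between 1 and \<open>b\<close>.\<close>
  define b where "b = Cf + 1"
  have b: "b \<ge> 1" using Cf by (simp add: b_def)
  have F_ge: "cmod (of_real b - f w) \<ge> 1" if "w \<in> sector \<alpha>" for w
    using norm_triangle_ineq2[of "of_real b" "f w"] f_le[OF that] b by (simp add: b_def)
  have F_class: "(\<lambda>w. of_real b - f w) \<in> ultrahol_class \<omega> (sector \<alpha>)"
  proof (rule ultrahol_classI[of _ _ lf "Cf + b"])
    fix w j assume w: "w \<in> sector \<alpha>"
    obtain f1 where f1: "f1 analytic_on {exp w}" "\<forall>\<^sub>F v in nhds w. f v = f1 (exp v)"
      "f1 (exp w) = f w" "\<And>j. (z_deriv ^^ j) f w = (deriv ^^ j) f1 (exp w)"
      using log_surface_chart[OF f_hol open_sector w] by metis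
    have "(z_deriv ^^ j) (\<lambda>w. of_real b - f w) w = (deriv ^^ j) (\<lambda>z. of_real b - f1 z) (exp w)"
      by (rule z_deriv_iterate_chart) (use f1 in \<open>auto intro!: analytic_intros elim: eventually_mono\<close>)
    also have "\<dots> = (deriv ^^ j) (\<lambda>_. of_real b) (exp w) - (z_deriv ^^ j) f w"
      unfolding f1(4) by (intro higher_deriv_diff_at f1(1) analytic_intros)
    also have "cmod \<dots> \<le> cmod ((deriv ^^ j) (\<lambda>_. complex_of_real b) (exp w)) + cmod ((z_deriv ^^ j) f w)"
      by (rule norm_triangle_ineq4)
    also have "\<dots> \<le> b * W lf j + Cf * W lf j"
    proof (intro add_mono f_bound w)
      have "cmod ((deriv ^^ j) (\<lambda>_. complex_of_real b) (exp w)) \<le> b * 1" using b by (cases j) auto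
      also have "\<dots> \<le> b * W lf j" using b lf by (intro mult_left_mono W_ge_1) auto
      finally show "cmod ((deriv ^^ j) (\<lambda>_. complex_of_real b) (exp w)) \<le> b * W lf j" .
    qed
    finally show "cmod ((z_deriv ^^ j) (\<lambda>w. of_real b - f w) w) \<le> (Cf + b) * W lf j"
      by (simp add: algebra_simps)
  qed (use lf Cf b f_hol in \<open>auto intro!: holomorphic_intros\<close>)
  have "(0::complex) \<in> sector \<alpha>" using \<alpha> by (simp add: sector_def)
  then have "(INF w\<in>sector \<alpha>. cmod (of_real b - f w)) \<ge> 1"
    using F_ge by (intro cINF_greatest) auto
  then have "(\<lambda>w. 1 / (of_real b - f w)) \<in> ultrahol_class \<omega> (sector \<alpha>)"
    using inv F_class unfolding inverse_closed_def by fastforce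
  then obtain lh Ch where lh: "lh > 0" and Ch: "Ch > 0" and
    h_bound: "\<And>w j. w \<in> sector \<alpha> \<Longrightarrow> cmod ((z_deriv ^^ j) (\<lambda>w. 1 / (of_real b - f w)) w) \<le> Ch * W lh j"
    unfolding ultrahol_class_iff by blast

  have point: "(c * exp (- real j) * exp (real j * y - phi y / l) / fact j) ^ n
      \<le> b ^ Suc n * (Ch * check_seq (W lh) (j * n))" if y: "y \<ge> 0" and j: "j \<ge> 1" for y j n
  proof -
    obtain x :: real and R where R: "\<And>j. R j \<ge> 0" "\<And>j. (z_deriv ^^ j) f (of_real x) = (- 1) ^ j * of_real (R j)"
      "\<And>j. R j \<ge> c * exp (- real j) * exp (real j * y - phi y / l)"
      using char[OF y] by blast
    define w where "w = complex_of_real x"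
    define z where "z = exp w"
    have w: "w \<in> sector \<alpha>" using \<alpha> by (simp add: sector_def w_def)
    obtain f1 where f1: "f1 analytic_on {z}" "\<forall>\<^sub>F v in nhds w. f v = f1 (exp v)"
      "f1 z = f w" "\<And>j. (z_deriv ^^ j) f w = (deriv ^^ j) f1 z"
      using log_surface_chart[OF f_hol open_sector w] unfolding z_def by metis
    define u where "u = b - R 0"
    have fw: "f w = of_real (R 0)" using R(2)[of 0] by (simp add: w_def)
    have u: "1 \<le> u" "u \<le> b" using f_le[OF w] R(1)[of 0] unfolding fw by (auto simp: u_def b_def)
    define h1 where "h1 v = 1 / (of_real b - f1 v)" for v
    have nz: "of_real b - f1 z \<noteq> 0" using F_ge[OF w] f1(3) by auto
    have h1: "h1 analytic_on {z}"
      unfolding h1_def[abs_def] using nz f1(1) by (intro analytic_intros) auto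
    have h_deriv: "(z_deriv ^^ j) (\<lambda>w. 1 / (of_real b - f w)) w = (deriv ^^ j) h1 z" for j
      unfolding z_def
      by (rule z_deriv_iterate_chart) (use h1 f1(2) in \<open>auto simp: z_def h1_def elim: eventually_mono\<close>)
    \<comment> \<open>Taylor coefficients of the reciprocal with the sign \<open>(- 1) ^ k\<close>
      removed; in this form the product rule for \<open>(b - f1) * h1 = 1\<close> becomes a
      recursion with nonnegative coefficients.\<close>
    define \<eta> where "\<eta> k = (- 1) ^ k * (deriv ^^ k) h1 z / fact k" for k
    have F1: "(\<lambda>v. of_real b - f1 v) analytic_on {z}" using f1(1) by (intro analytic_intros)
    have F1_deriv: "(deriv ^^ i) (\<lambda>v. of_real b - f1 v) z = (if i = 0 then of_real u else - ((- 1) ^ i * of_real (R i)))" for i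
    proof -
      have "(deriv ^^ i) (\<lambda>v. of_real b - f1 v) z = (deriv ^^ i) (\<lambda>_. of_real b) z - (deriv ^^ i) f1 z"
        by (intro higher_deriv_diff_at f1(1) analytic_intros)
      then show ?thesis using f1(4)[of i] R(2)[of i] unfolding w_def[symmetric] by (cases i) (auto simp: u_def)
    qed
    have rec: "of_real u * \<eta> k = (\<Sum>i = 1..k. of_real (R i / fact i) * \<eta> (k - i))" if k: "k \<ge> 1" for k
    proof -
      have "((\<lambda>v. of_real b - f1 v) \<longlongrightarrow> of_real b - f1 z) (nhds z)"
        using analytic_at_imp_isCont[OF F1] tendsto_at_iff_tendsto_nhds[of "\<lambda>v. of_real b - f1 v" z]
        by (simp add: isCont_def)
      then have "\<forall>\<^sub>F v in nhds z. of_real b - f1 v \<noteq> 0"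
        using nz by (rule tendsto_imp_eventually_ne)
      then have "\<forall>\<^sub>F v in nhds z. (of_real b - f1 v) * h1 v = 1"
        by eventually_elim (simp add: h1_def)
      then have "(deriv ^^ k) (\<lambda>v. (of_real b - f1 v) * h1 v) z = (deriv ^^ k) (\<lambda>_. 1) z"
        by (rule higher_deriv_cong_ev) simp
      then have "(\<Sum>i = 0..k. of_nat (k choose i) * (deriv ^^ i) (\<lambda>v. of_real b - f1 v) z * (deriv ^^ (k - i)) h1 z) = 0"
        using k by (subst (asm) higher_deriv_mult_at[OF F1 h1]) auto
      moreover have "{0..k} = insert 0 {1..k}" by auto
      ultimately have "of_real u * (deriv ^^ k) h1 z
          = (\<Sum>i = 1..k. of_nat (k choose i) * ((- 1) ^ i * of_real (R i)) * (deriv ^^ (k - i)) h1 z)"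
        by (simp add: F1_deriv sum_negf)
      then have "of_real u * \<eta> k = (- 1) ^ k / fact k *
          (\<Sum>i = 1..k. of_nat (k choose i) * ((- 1) ^ i * of_real (R i)) * (deriv ^^ (k - i)) h1 z)"
        by (simp add: \<eta>_def)
      also have "\<dots> = (\<Sum>i = 1..k. of_real (R i / fact i) * \<eta> (k - i))"
        unfolding sum_distrib_left
      proof (rule sum.cong[OF refl])
        fix i assume "i \<in> {1..k}"
        then have i: "i \<le> k" by simp
        have sign: "(- 1) ^ k * (- 1) ^ i = ((- 1) ^ (k - i) :: complex)"
        proof -
          have "(- 1) ^ k = ((- 1) ^ (k - i) * (- 1) ^ i :: complex)" using i by (simp flip: power_add)
          then show ?thesis by (simp add: mult.assoc power_mult_distrib[symmetric])
        qed
        have "(- 1) ^ k / fact k * (of_nat (k choose i) * ((- 1) ^ i * of_real (R i)) * (deriv ^^ (k - i)) h1 z)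
            = ((- 1) ^ k * (- 1) ^ i) * (of_nat (k choose i) / fact k) * of_real (R i) * (deriv ^^ (k - i)) h1 z"
          by simp
        also have "(of_nat (k choose i) / fact k :: complex) = 1 / (fact i * fact (k - i))"
          using i by (simp add: binomial_fact)
        finally show "(- 1) ^ k / fact k * (of_nat (k choose i) * ((- 1) ^ i * of_real (R i)) * (deriv ^^ (k - i)) h1 z)
            = of_real (R i / fact i) * \<eta> (k - i)"
          unfolding sign by (simp add: \<eta>_def)
      qed
      finally show ?thesis .
    qed
    have "\<eta> 0 = of_real (1 / u)" using f1(3) fw by (simp add: \<eta>_def h1_def u_def)
    then have "(R j / fact j) ^ n / u ^ Suc n \<le> norm (\<eta> (j * n))"
      using u R(1) j by (intro reciprocal_coeffs_ge rec) auto
    also have "norm (\<eta> (j * n)) = cmod ((z_deriv ^^ (j * n)) (\<lambda>w. 1 / (of_real b - f w)) w) / fact (j * n)"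
      by (simp add: \<eta>_def h_deriv norm_mult norm_divide norm_power)
    also have "\<dots> \<le> Ch * check_seq (W lh) (j * n)"
      using divide_right_mono[OF h_bound[OF w, of "j * n"], of "fact (j * n)"] by (simp add: check_seq_def)
    finally have "(R j / fact j) ^ n \<le> u ^ Suc n * (Ch * check_seq (W lh) (j * n))"
      using u by (simp add: field_simps)
    also have "\<dots> \<le> b ^ Suc n * (Ch * check_seq (W lh) (j * n))"
      using u Ch by (intro mult_right_mono power_mono) (auto simp: check_seq_def less_imp_le)
    finally have R_le: "(R j / fact j) ^ n \<le> b ^ Suc n * (Ch * check_seq (W lh) (j * n))" .
    have "(c * exp (- real j) * exp (real j * y - phi y / l) / fact j) ^ n \<le> (R j / fact j) ^ n"
      using R(3)[of j] c by (intro power_mono divide_right_mono) auto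
    with R_le show ?thesis by linarith
  qed
  \<comment> \<open>The factor \<open>b\<^sup>2\<close> comes from
    \<open>n + 1 \<le> 2 * (j * n)\<close>; the factor \<open>exp 1\<close> absorbs
    \<open>exp (- real j)\<close> from the lower bound for the derivatives.\<close>
  define D where "D = exp 1 * max 1 (1 / c) * b\<^sup>2 * max 1 Ch"
  have "check_seq (W l) j ^ n \<le> D ^ (j * n) * check_seq (W lh) (j * n)" if j: "j \<ge> 1" and n: "n \<ge> 1" for j n
  proof -
    define Z where "Z = b ^ Suc n * (Ch * check_seq (W lh) (j * n))"
    have check_pos: "check_seq (W l) i > 0" for l i by (simp add: check_seq_def)
    have Z: "Z \<ge> 0" using b Ch check_pos[of lh "j * n"] by (simp add: Z_def)
    \<comment> \<open>The right-hand side of \<open>point\<close> is free of \<open>y\<close>, so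
      after taking \<open>n\<close>-th roots the supremum over \<open>y\<close> turns the single
      exponentials into \<open>W l j\<close>.\<close>
    have "W l j \<le> root n Z * fact j * exp (real j) / c"
    proof (rule W_le[OF l])
      fix y :: real assume y: "y \<ge> 0"
      have "c * exp (- real j) * exp (real j * y - phi y / l) / fact j
          = root n ((c * exp (- real j) * exp (real j * y - phi y / l) / fact j) ^ n)"
        using n c by (subst real_root_power_cancel) auto
      also have "\<dots> \<le> root n Z" using point[OF y j, of n] n by (simp add: Z_def)
      finally show "exp (real j * y - phi y / l) \<le> root n Z * fact j * exp (real j) / c"
        using c by (simp add: exp_minus field_simps)
    qed
    then have "check_seq (W l) j \<le> root n Z * exp (real j) / c" by (simp add: check_seq_def field_simps)
    then have "check_seq (W l) j ^ n \<le> (root n Z * exp (real j) / c) ^ n"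
      using check_pos[of l j] by (intro power_mono) auto
    also have "\<dots> = exp 1 ^ (j * n) * (1 / c) ^ n * b ^ Suc n * Ch * check_seq (W lh) (j * n)"
      using n Z by (simp add: power_mult_distrib power_divide Z_def exp_of_nat_mult[symmetric] mult_ac)
    also have "\<dots> \<le> exp 1 ^ (j * n) * max 1 (1 / c) ^ (j * n) * (b\<^sup>2) ^ (j * n) * max 1 Ch ^ (j * n) * check_seq (W lh) (j * n)"
    proof (intro mult_right_mono mult_mono)
      have jn: "n \<le> j * n" "Suc n \<le> 2 * (j * n)" "j * n > 0" using j n by (auto simp: Suc_le_eq)
      show "(1 / c) ^ n \<le> max 1 (1 / c) ^ (j * n)"
        using power_mono[of "1 / c" "max 1 (1 / c)" n] power_increasing[OF jn(1), of "max 1 (1 / c)"] c by simp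
      show "b ^ Suc n \<le> (b\<^sup>2) ^ (j * n)"
        unfolding power_mult[symmetric] using power_increasing[OF jn(2) b] by (simp add: mult.commute)
      show "Ch \<le> max 1 Ch ^ (j * n)"
        using jn self_le_power[of "max 1 Ch" "j * n"] by simp
    qed (use b c Ch check_pos in \<open>auto simp: less_imp_le\<close>)
    also have "\<dots> = D ^ (j * n) * check_seq (W lh) (j * n)"
      unfolding D_def power_mult_distrib by simp
    finally show ?thesis .
  qed
  moreover have "D \<ge> 1"
    unfolding D_def using b by (intro mult_ge1_I one_le_power) auto
  ultimately show "\<exists>l'>0. \<exists>D\<ge>1. \<forall>j\<ge>1. \<forall>n\<ge>1.
     check_seq (W l) j ^ n \<le> D ^ (j * n) * check_seq (W l') (j * n)"
    using lh by blast
qed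

end

theorem theorem6p5:
  fixes \<omega> :: "real \<Rightarrow> real" and \<alpha> :: real
  assumes "\<omega> \<in> weight_fun_W0"
    and "\<alpha> > 1"
    and "\<exists>s>\<alpha> - 1. power_weight \<omega> s \<in> o[at_top](\<lambda>t. t) \<and> alpha0 (power_weight \<omega> s)"
  shows "(M_rai (weight_matrix \<omega>) \<longleftrightarrow> alpha0 \<omega>) \<and>
         (M_rai (weight_matrix \<omega>) \<longleftrightarrow> holomorphically_closed \<omega> (sector \<alpha>)) \<and>
         (M_rai (weight_matrix \<omega>) \<longleftrightarrow> inverse_closed \<omega> (sector \<alpha>)) \<and>
         (\<omega> \<in> O[at_top](\<lambda>t. t) \<longrightarrow>
            (M_rai (weight_matrix \<omega>) \<longleftrightarrow> composition_closed \<omega> (sector \<alpha>)) \<and>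
            (M_rai (weight_matrix \<omega>) \<longleftrightarrow> M_FdB (weight_matrix \<omega>)))"
proof -
  interpret weight_W0 \<omega> by unfold_locales (rule assms(1))
  obtain s where s: "s > \<alpha> - 1" "alpha0 (power_weight \<omega> s)" using assms(3) by blast
  have ab: "rai_log \<longleftrightarrow> alpha0 \<omega>" using rai_log_imp_alpha0 alpha0_imp_rai_log by blast
  have ac: "rai_log \<Longrightarrow> holomorphically_closed \<omega> (sector \<alpha>)"
    by (rule rai_imp_holomorphically_closed[OF _ open_sector])
  \<comment> \<open>Here \<open>\<alpha> > 1\<close> guarantees that \<open>s\<close> is
    positive.\<close>
  have da: "inverse_closed \<omega> (sector \<alpha>) \<Longrightarrow> rai_log"
    using s assms(2) by (intro inverse_closed_imp_rai_log) auto
  show ?thesis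
    unfolding M_rai_iff_rai_log
    using ab ac da holomorphically_closed_imp_inverse_closed holomorphically_closed_imp_composition_closed
      composition_closed_imp_inverse_closed rai_imp_FdB FdB_imp_rai_log
    by blast
qed

end
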